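(* Let $\Omega\subseteq\mathbb R^n$ be a bounded domain with Lipschitz boundary, and let $a\ge 0$. Assume the following hypothesis $(H_0)$ on the weight $a$ and the exponents $p,q$: $$a\in C^{0,1}(\overline\Omega)\cap A_q,\quad a(x)\neq 0\ \text{ on }\partial\Omega,\quad 1<p<q<n\quad\text{and}\quad \frac{q}{p}<1+\frac1n .$$ Let $f\in L^n(\Omega)$ satisfy $$\|f\|_{n}\,(S(n,1)+1)<1 .$$ Then the solution (in the sense defined in the context) of the Dirichlet problem $$-\operatorname{div}\Big(\frac{\nabla u}{|\nabla u|}+a(x)|\nabla u|^{q-2}\nabla u\Big)=f\ \text{ in }\Omega,\qquad u=0\ \text{ on }\partial\Omega$$ is unique.
   Context: $C^{0,1}(\overline\Omega)$ is the space of Lipschitz functions on $\overline\Omega$, and $\|\cdot\|_n$ is the norm of $L^n(\Omega)$. The exponent $p$ in $(H_0)$ is that of the intermediate double phase problems $-\operatorname{div}(|\nabla u|^{p-2}\nabla u+a(x)|\nabla u|^{q-2}\nabla u)=f$ in $\Omega$, $u=0$ on $\partial\Omega$, whose weak solutions $u_p$ are used to construct a solution by letting $p\to1$; it does not appear in the limit problem. Muckenhoupt class: a weight $a\in L^\infty(\Omega)$ with $a(x)>0$ a.e. in $\Omega$ belongs to $A_q$ if $$\sup_Q\Big(\frac1{|Q|}\int_Q a(x)\,dx\Big)\Big(\frac1{|Q|}\int_Q a(x)^{-\frac1{q-1}}\,dx\Big)^{q-1}<\infty,$$ the supremum being taken over all cubes $Q$ with sides parallel to the coordinate axes. $S(n,p)$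 denotes the best constant of the classical Sobolev embedding of $W^{1,p}_0$ into $L^{p^*}$, $p^*=\frac{np}{n-p}$; $S(n,1)$ is this constant for $p=1$. Weighted spaces: $\theta_0(x,t)=a(x)t^q$; $L^{\theta_0}(\Omega)$ is the weighted Lebesgue space with Luxemburg norm $\|u\|_{\theta_0}=\inf\{\lambda>0:\int_\Omega a|u/\lambda|^q\,dx\le1\}=(\int_\Omega a|u|^q\,dx)^{1/q}$. $W^{1,\theta_0}(\Omega)=\{u\in L^{\theta_0}(\Omega):\nabla u\in L^{\theta_0}(\Omega;\mathbb R^n)\}$ has norm $\|u\|_{1,\theta_0}=\|u\|_{\theta_0}+\|\nabla u\|_{\theta_0}$, and $W^{1,\theta_0}_0(\Omega)$ is the closure of $C_0^\infty(\Omega)$ in this norm. $BV(\Omega)$ is the space of $u\in L^1(\Omega)$ whose distributional derivative $Du$ is a (finite) Radon measure; $|Du|$ is its total variation. Pairing: if $z\in L^\infty(\Omega;\mathbb R^n)$ is a vector field whose distributional divergence $\operatorname{div}z$ belongs to $L^\infty(\Omega)$ and $u\in BV(\Omega)$, the distribution $(z,Du)$ is defined (Anzellotti) by $$\langle (z,Du),\phi\rangle=-\int_\Omega u\,z\cdot\nabla\phi\,dx-\int_\Omega u\,\phi\operatorname{div}z\,dx,\qquad \phi\in C_0^\infty(\Omega).$$ Notion of solution: $u\in BV(\Omega)\cap W^{1,\theta_0}_0(\Omega)$ is a solution of the Dirichlet problem if there exists a vector field $z\in L^\infty(\Omega;\mathbb R^n)$ with $\|z\|_\infty\le1$ such that (i)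 $\int_\Omega \big(z\cdot\nabla\phi+a(x)|\nabla u|^{q-2}\nabla u\cdot\nabla\phi\big)\,dx=\int_\Omega f\phi\,dx$ for all $\phi\in C_0^\infty(\Omega)$; (ii) $-\operatorname{div}z-\Delta^a_q u=f$ as distributions in $\Omega$, where $\Delta^a_q u=\operatorname{div}(a(x)|\nabla u|^{q-2}\nabla u)$; (iii) $(z,Du)=|Du|$ as measures in $\Omega$. Functions are identified when they agree a.e. in $\Omega$. *)

theory Defs
  imports "HOL-Analysis.Analysis"
begin

text \<open>Functions on \<open>\<Omega>\<close> are total functions on \<open>real ^ 'n\<close> of which only the values on \<open>\<Omega>\<close>
  (for the weight \<open>a\<close>: on \<open>closure \<Omega>\<close>) matter; \<open>n\<close> is \<open>CARD('n)\<close>.\<close>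

section \<open>Domains, cubes, weights\<close>

text \<open>Near each boundary point \<open>\<Omega>\<close> is the strict epigraph of a Lipschitz function \<open>\<gamma>\<close> of the
  \<open>n - 1\<close> variables in the hyperplane orthogonal to a suitable unit vector \<open>v\<close>.\<close>

definition lipschitz_boundary :: "(real ^ 'n) set \<Rightarrow> bool" where
  "lipschitz_boundary \<Omega> \<longleftrightarrow>
     (\<forall>x\<in>frontier \<Omega>. \<exists>r>0. \<exists>v L \<gamma>. norm v = 1 \<and> L-lipschitz_on {y. y \<bullet> v = 0} (\<gamma> :: real ^ 'n \<Rightarrow> real) \<and>
        \<Omega> \<inter> ball x r = {y \<in> ball x r. \<gamma> (y - (y \<bullet> v) *\<^sub>R v) < y \<bullet> v})"

definition bounded_lipschitz_domain :: "(real ^ 'n) set \<Rightarrow> bool" where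
  "bounded_lipschitz_domain \<Omega> \<longleftrightarrow>
     open \<Omega> \<and> connected \<Omega> \<and> \<Omega> \<noteq> {} \<and> bounded \<Omega> \<and> lipschitz_boundary \<Omega>"

definition Linfty :: "(real ^ 'n) set \<Rightarrow> (real ^ 'n \<Rightarrow> 'b::euclidean_space) \<Rightarrow> bool" where
  "Linfty \<Omega> g \<longleftrightarrow> g \<in> borel_measurable (lebesgue_on \<Omega>) \<and> (\<exists>C. AE x in lebesgue_on \<Omega>. norm (g x) \<le> C)"

definition cubes_in :: "(real ^ 'n) set \<Rightarrow> (real ^ 'n) set set" where
  "cubes_in \<Omega> = {Q. Q \<subseteq> \<Omega> \<and> (\<exists>c r. r > 0 \<and> Q = cbox c (c + (\<chi> i. r)))}"

definition mean_on :: "(real ^ 'n) set \<Rightarrow> (real ^ 'n \<Rightarrow> real) \<Rightarrow> real" where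
  "mean_on Q g = (LINT x|lebesgue_on Q. g x) / measure lebesgue Q"

text \<open>The weight lives on \<open>\<Omega>\<close>, so the cubes are those contained in \<open>\<Omega>\<close>. Finiteness of the
  supremum includes finiteness of each integral; as the integral of a non-integrable function is
  \<open>0\<close>, this is required explicitly.\<close>

definition muckenhoupt :: "(real ^ 'n) set \<Rightarrow> real \<Rightarrow> (real ^ 'n \<Rightarrow> real) \<Rightarrow> bool" where
  "muckenhoupt \<Omega> q a \<longleftrightarrow>
     Linfty \<Omega> a \<and> (AE x in lebesgue_on \<Omega>. a x > 0) \<and>
     (\<forall>Q\<in>cubes_in \<Omega>. integrable (lebesgue_on Q) (\<lambda>x. a x powr (- 1 / (q - 1)))) \<and>
     bdd_above ((\<lambda>Q. mean_on Q a * mean_on Q (\<lambda>x. a x powr (- 1 / (q - 1))) powr (q - 1)) ` cubes_in \<Omega>)"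

section \<open>Test functions and weak gradients\<close>

definition grad :: "(real ^ 'n \<Rightarrow> real) \<Rightarrow> real ^ 'n \<Rightarrow> real ^ 'n" where
  "grad \<phi> x = (\<chi> i. frechet_derivative \<phi> (at x) (axis i 1))"

primrec Ck :: "nat \<Rightarrow> (real ^ 'n \<Rightarrow> real) \<Rightarrow> bool" where
  "Ck 0 \<phi> \<longleftrightarrow> continuous_on UNIV \<phi>"
| "Ck (Suc k) \<phi> \<longleftrightarrow> (\<forall>x. \<phi> differentiable (at x)) \<and> (\<forall>i. Ck k (\<lambda>x. grad \<phi> x $ i))"

text \<open>\<open>C\<^sub>0\<^sup>\<infinity>(\<Omega>)\<close>, extended by zero.\<close>

definition test_fun :: "(real ^ 'n) set \<Rightarrow> (real ^ 'n \<Rightarrow> real) \<Rightarrow> bool" where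
  "test_fun \<Omega> \<phi> \<longleftrightarrow> (\<forall>k. Ck k \<phi>) \<and> compact (closure {x. \<phi> x \<noteq> 0}) \<and> closure {x. \<phi> x \<noteq> 0} \<subseteq> \<Omega>"

definition locally_integrable :: "(real ^ 'n) set \<Rightarrow> (real ^ 'n \<Rightarrow> 'b::euclidean_space) \<Rightarrow> bool" where
  "locally_integrable \<Omega> g \<longleftrightarrow> (\<forall>K. compact K \<and> K \<subseteq> \<Omega> \<longrightarrow> integrable (lebesgue_on K) g)"

definition is_weak_grad :: "(real ^ 'n) set \<Rightarrow> (real ^ 'n \<Rightarrow> real) \<Rightarrow> (real ^ 'n \<Rightarrow> real ^ 'n) \<Rightarrow> bool" where
  "is_weak_grad \<Omega> u G \<longleftrightarrow> locally_integrable \<Omega> u \<and> locally_integrable \<Omega> G \<and>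
     (\<forall>\<phi> i. test_fun \<Omega> \<phi> \<longrightarrow>
        (LINT x|lebesgue_on \<Omega>. u x * grad \<phi> x $ i) = - (LINT x|lebesgue_on \<Omega>. G x $ i * \<phi> x))"

text \<open>Determined up to a null set, and arbitrary if there is no weak gradient.\<close>

definition wgrad :: "(real ^ 'n) set \<Rightarrow> (real ^ 'n \<Rightarrow> real) \<Rightarrow> real ^ 'n \<Rightarrow> real ^ 'n" where
  "wgrad \<Omega> u = (SOME G. is_weak_grad \<Omega> u G)"

section \<open>Weighted Lebesgue and Sobolev spaces\<close>

text \<open>For \<open>w = 1\<close> these are the usual spaces \<open>L\<^sup>q\<close>, \<open>W\<^sup>1\<^sup>,\<^sup>q\<close> and \<open>W\<^sub>0\<^sup>1\<^sup>,\<^sup>q\<close>;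
  for \<open>w = a\<close> they are those attached to \<open>\<theta>\<^sub>0(x,t) = a(x) t\<^sup>q\<close>.\<close>

definition in_L :: "(real ^ 'n) set \<Rightarrow> (real ^ 'n \<Rightarrow> real) \<Rightarrow> real \<Rightarrow> (real ^ 'n \<Rightarrow> 'b::euclidean_space) \<Rightarrow> bool" where
  "in_L \<Omega> w q g \<longleftrightarrow> g \<in> borel_measurable (lebesgue_on \<Omega>) \<and>
     integrable (lebesgue_on \<Omega>) (\<lambda>x. w x * norm (g x) powr q)"

definition norm_L :: "(real ^ 'n) set \<Rightarrow> (real ^ 'n \<Rightarrow> real) \<Rightarrow> real \<Rightarrow> (real ^ 'n \<Rightarrow> 'b::euclidean_space) \<Rightarrow> real" where
  "norm_L \<Omega> w q g = (LINT x|lebesgue_on \<Omega>. w x * norm (g x) powr q) powr (1 / q)"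

definition in_W :: "(real ^ 'n) set \<Rightarrow> (real ^ 'n \<Rightarrow> real) \<Rightarrow> real \<Rightarrow> (real ^ 'n \<Rightarrow> real) \<Rightarrow> bool" where
  "in_W \<Omega> w q u \<longleftrightarrow> in_L \<Omega> w q u \<and> (\<exists>G. is_weak_grad \<Omega> u G) \<and> in_L \<Omega> w q (wgrad \<Omega> u)"

definition norm_W :: "(real ^ 'n) set \<Rightarrow> (real ^ 'n \<Rightarrow> real) \<Rightarrow> real \<Rightarrow> (real ^ 'n \<Rightarrow> real) \<Rightarrow> real" where
  "norm_W \<Omega> w q u = norm_L \<Omega> w q u + norm_L \<Omega> w q (wgrad \<Omega> u)"

definition in_W0 :: "(real ^ 'n) set \<Rightarrow> (real ^ 'n \<Rightarrow> real) \<Rightarrow> real \<Rightarrow> (real ^ 'n \<Rightarrow> real) \<Rightarrow> bool" where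
  "in_W0 \<Omega> w q u \<longleftrightarrow> in_W \<Omega> w q u \<and>
     (\<forall>e>0. \<exists>\<phi>. test_fun \<Omega> \<phi> \<and> norm_W \<Omega> w q (\<lambda>x. u x - \<phi> x) < e)"

text \<open>\<open>S(n,p)\<close>, the least constant in \<open>\<parallel>u\<parallel> \<le> C \<parallel>\<nabla>u\<parallel>\<close> (norms of \<open>L\<^sup>p\<^sup>*\<close> and \<open>L\<^sup>p\<close>). It is the same
  for all open subsets of \<open>\<real>\<^sup>n\<close>; it is taken here on the whole space.\<close>

definition sobolev_const :: "'n::finite itself \<Rightarrow> real \<Rightarrow> real" where
  "sobolev_const _ p =
     (let n = real CARD('n); ps = n * p / (n - p) in
      Inf {C. 0 \<le> C \<and>
        (\<forall>u :: real ^ 'n \<Rightarrow> real. in_W0 UNIV (\<lambda>_. 1) p u \<longrightarrow>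
           in_L UNIV (\<lambda>_. 1) ps u \<and>
           norm_L UNIV (\<lambda>_. 1) ps u \<le> C * norm_L UNIV (\<lambda>_. 1) p (wgrad UNIV u))})"

section \<open>Functions of bounded variation\<close>

definition borel_on :: "(real ^ 'n) set \<Rightarrow> (real ^ 'n) set set" where
  "borel_on \<Omega> = sets (restrict_space borel \<Omega>)"

text \<open>\<open>Du\<close> is the vector measure whose components are the differences \<open>P i - N i\<close> of finite Borel
  measures on \<open>\<Omega>\<close>.\<close>

definition is_D :: "(real ^ 'n) set \<Rightarrow> (real ^ 'n \<Rightarrow> real) \<Rightarrow>
    ('n \<Rightarrow> (real ^ 'n) measure) \<Rightarrow> ('n \<Rightarrow> (real ^ 'n) measure) \<Rightarrow> bool" where
  "is_D \<Omega> u P N \<longleftrightarrow>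
     (\<forall>i. finite_measure (P i) \<and> finite_measure (N i) \<and>
          sets (P i) = borel_on \<Omega> \<and> sets (N i) = borel_on \<Omega>) \<and>
     (\<forall>\<phi> i. test_fun \<Omega> \<phi> \<longrightarrow>
        (LINT x|lebesgue_on \<Omega>. u x * grad \<phi> x $ i) = - ((LINT x|P i. \<phi> x) - (LINT x|N i. \<phi> x)))"

definition BV :: "(real ^ 'n) set \<Rightarrow> (real ^ 'n \<Rightarrow> real) \<Rightarrow> bool" where
  "BV \<Omega> u \<longleftrightarrow> integrable (lebesgue_on \<Omega>) u \<and> (\<exists>P N. is_D \<Omega> u P N)"

text \<open>\<open>\<mu>\<close> is the total variation \<open>|Du|\<close>: the supremum over countable Borel partitions.\<close>

definition is_abs_D :: "(real ^ 'n) set \<Rightarrow> (real ^ 'n \<Rightarrow> real) \<Rightarrow> (real ^ 'n) measure \<Rightarrow> bool" where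
  "is_abs_D \<Omega> u \<mu> \<longleftrightarrow> sets \<mu> = borel_on \<Omega> \<and>
     (\<exists>P N. is_D \<Omega> u P N \<and>
        (\<forall>B\<in>borel_on \<Omega>. emeasure \<mu> B =
           (SUP E\<in>{E :: nat \<Rightarrow> (real ^ 'n) set.
                     range E \<subseteq> borel_on \<Omega> \<and> disjoint_family E \<and> (\<Union>k. E k) = B}.
              \<Sum>k. ennreal (norm (\<chi> i. measure (P i) (E k) - measure (N i) (E k))))))"

section \<open>The pairing\<close>

definition distr_div :: "(real ^ 'n) set \<Rightarrow> (real ^ 'n \<Rightarrow> real ^ 'n) \<Rightarrow> (real ^ 'n \<Rightarrow> real) \<Rightarrow> real" where
  "distr_div \<Omega> F \<phi> = - (LINT x|lebesgue_on \<Omega>. F x \<bullet> grad \<phi> x)"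

definition is_Linfty_div :: "(real ^ 'n) set \<Rightarrow> (real ^ 'n \<Rightarrow> real ^ 'n) \<Rightarrow> (real ^ 'n \<Rightarrow> real) \<Rightarrow> bool" where
  "is_Linfty_div \<Omega> z g \<longleftrightarrow> Linfty \<Omega> g \<and>
     (\<forall>\<phi>. test_fun \<Omega> \<phi> \<longrightarrow> distr_div \<Omega> z \<phi> = (LINT x|lebesgue_on \<Omega>. g x * \<phi> x))"

text \<open>\<open>c\<close> is the value of \<open>div z\<close> on \<open>\<psi>\<close>. If \<open>div z \<in> L\<^sup>\<infinity>\<close>, it is \<open>\<integral> \<psi> div z\<close>, as in
  Anzellotti's definition. For the field \<open>z\<close> of a solution, \<open>div z = - f - \<Delta>\<^sub>q\<^sup>a u\<close> need not be
  bounded, nor a function. As \<open>z \<in> L\<^sup>\<infinity>\<close>, the distribution \<open>div z\<close> is continuous for the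
  \<open>W\<^sup>1\<^sup>,\<^sup>1\<close> norm, and outside Anzellotti's case it is evaluated on \<open>\<psi>\<close> by this continuity.
  The second case is disjoint from the first, and it gives the same value where both make sense.\<close>

definition div_value :: "(real ^ 'n) set \<Rightarrow> (real ^ 'n \<Rightarrow> real ^ 'n) \<Rightarrow> (real ^ 'n \<Rightarrow> real) \<Rightarrow> real \<Rightarrow> bool" where
  "div_value \<Omega> z \<psi> c \<longleftrightarrow>
     (if \<exists>g. is_Linfty_div \<Omega> z g
      then \<exists>g. is_Linfty_div \<Omega> z g \<and> c = (LINT x|lebesgue_on \<Omega>. \<psi> x * g x)
      else in_W \<Omega> (\<lambda>_. 1) 1 \<psi> \<and>
        (\<exists>\<Phi> :: nat \<Rightarrow> real ^ 'n \<Rightarrow> real. (\<forall>k. test_fun \<Omega> (\<Phi> k)) \<and>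
           (\<lambda>k. norm_W \<Omega> (\<lambda>_. 1) 1 (\<lambda>x. \<psi> x - \<Phi> k x)) \<longlonglongrightarrow> 0 \<and>
           (\<lambda>k. distr_div \<Omega> z (\<Phi> k)) \<longlonglongrightarrow> c))"

text \<open>\<open>\<langle>(z,Du),\<phi>\<rangle> = t\<close>.\<close>

definition pairing_value :: "(real ^ 'n) set \<Rightarrow> (real ^ 'n \<Rightarrow> real ^ 'n) \<Rightarrow> (real ^ 'n \<Rightarrow> real) \<Rightarrow>
    (real ^ 'n \<Rightarrow> real) \<Rightarrow> real \<Rightarrow> bool" where
  "pairing_value \<Omega> z u \<phi> t \<longleftrightarrow>
     (\<exists>c. div_value \<Omega> z (\<lambda>x. u x * \<phi> x) c \<and>
          t = - (LINT x|lebesgue_on \<Omega>. u x * (z x \<bullet> grad \<phi> x)) - c)"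

section \<open>Solutions of the Dirichlet problem\<close>

definition q_flux :: "(real ^ 'n) set \<Rightarrow> (real ^ 'n \<Rightarrow> real) \<Rightarrow> real \<Rightarrow> (real ^ 'n \<Rightarrow> real) \<Rightarrow>
    real ^ 'n \<Rightarrow> real ^ 'n" where
  "q_flux \<Omega> a q u x = (a x * norm (wgrad \<Omega> u x) powr (q - 2)) *\<^sub>R wgrad \<Omega> u x"

definition is_solution :: "(real ^ 'n) set \<Rightarrow> (real ^ 'n \<Rightarrow> real) \<Rightarrow> real \<Rightarrow> (real ^ 'n \<Rightarrow> real) \<Rightarrow>
    (real ^ 'n \<Rightarrow> real) \<Rightarrow> bool" where
  "is_solution \<Omega> a q f u \<longleftrightarrow> BV \<Omega> u \<and> in_W0 \<Omega> a q u \<and>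
     (\<exists>z. z \<in> borel_measurable (lebesgue_on \<Omega>) \<and> (AE x in lebesgue_on \<Omega>. norm (z x) \<le> 1) \<and>
        (\<forall>\<phi>. test_fun \<Omega> \<phi> \<longrightarrow>
           (LINT x|lebesgue_on \<Omega>. z x \<bullet> grad \<phi> x + q_flux \<Omega> a q u x \<bullet> grad \<phi> x) =
           (LINT x|lebesgue_on \<Omega>. f x * \<phi> x)) \<and>
        (\<forall>\<phi>. test_fun \<Omega> \<phi> \<longrightarrow>
           - distr_div \<Omega> z \<phi> - distr_div \<Omega> (q_flux \<Omega> a q u) \<phi> = (LINT x|lebesgue_on \<Omega>. f x * \<phi> x)) \<and>
        (\<exists>\<mu>. is_abs_D \<Omega> u \<mu> \<and>
           (\<forall>\<phi>. test_fun \<Omega> \<phi> \<longrightarrow> pairing_value \<Omega> z u \<phi> (LINT x|\<mu>. \<phi> x))))"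

end

theory Submission
  imports Defs
begin

text \<open>As \<open>a > 0\<close> on the boundary and \<open>a\<close> is a Muckenhoupt weight, \<open>a powr (-1/(q-1))\<close> is
  integrable on \<open>\<Omega>\<close>; hence convergence in the weighted Sobolev space implies convergence in
  \<open>W\<^sup>1\<^sup>,\<^sup>1\<close>, and for a solution \<open>u\<close> the measure \<open>Du\<close> has density \<open>\<nabla>u\<close>. The pairing condition then
  reads \<open>z \<cdot> \<nabla>u = |\<nabla>u|\<close> almost everywhere. For two solutions \<open>u, v\<close> with fields \<open>z, w\<close>, subtracting the
  equations and testing with \<open>u - v\<close> (a limit of test functions) gives
  \<open>\<integral> (z - w) \<cdot> (\<nabla>u - \<nabla>v) + a (|\<nabla>u|\<^sup>q\<^sup>-\<^sup>2 \<nabla>u - |\<nabla>v|\<^sup>q\<^sup>-\<^sup>2 \<nabla>v) \<cdot> (\<nabla>u - \<nabla>v) = 0\<close>,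
  where both summands are nonnegative. By strict monotonicity \<open>\<nabla>u = \<nabla>v\<close>, and a Poincare inequality
  gives \<open>u = v\<close>.\<close>

section \<open>Smooth functions and test functions\<close>

text \<open>The pairing condition is the first obstacle, since \<open>div z\<close> need not be a
  function and \<open>div_value\<close> has two cases. Both lead to one formula: in either case the
  value on \<open>u * \<phi>\<close> is a limit of integrals of \<open>z\<close> against gradients
  of test functions, and these gradients converge in L^1 to the weak gradient of
  \<open>u * \<phi>\<close>. In (z, Du) the terms with the gradient of \<phi> then cancel. The
  measure |Du| enters through its finiteness and the bound |Du(B)| <= |Du|(B), which is carried over
  from sets B to nonnegative test functions. The second obstacle is that \<open>a\<close> may
  degenerate inside the domain. Limits in the weighted norm rest on Young's inequality with a free
  parameter, applied to integrals of a |f|^(q-1) |g| with f fixed. Taking a^(-1/(q-1)) for f turns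
  such an integral into the integral of |g|, so one estimate serves both weighted and L^1
  limits.\<close>

lemma grad_nth:
  assumes "(f has_derivative f') (at x)"
  shows "grad f x $ i = f' (axis i 1)"
  using frechet_derivative_at[OF assms] by (simp add: grad_def)

lemma Ck_Suc_imp: "Ck (Suc k) f \<Longrightarrow> Ck k f"
proof (induction k arbitrary: f)
  case 0
  then show ?case
    by (auto simp: continuous_on_eq_continuous_at intro!: differentiable_imp_continuous_within)
next
  case (Suc k)
  then show ?case by (metis Ck.simps(2))
qed

lemma Ck_continuous: "Ck k f \<Longrightarrow> continuous_on UNIV f"
  by (induction k) (use Ck_Suc_imp in auto)

lemma Ck_const [simp]: "Ck k (\<lambda>x :: real ^ 'n. c)"
proof (induction k arbitrary: c)
  case (Suc k)
  have "grad (\<lambda>x. c) x $ i = 0" for x :: "real ^ 'n" and i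
    by (subst grad_nth[where f'="\<lambda>h. 0"]) auto
  with Suc show ?case by simp
qed simp

lemma grad_add:
  assumes "f differentiable (at x)" "g differentiable (at x)"
  shows "grad (\<lambda>x. f x + g x) x = grad f x + grad g x"
proof -
  have "((\<lambda>x. f x + g x) has_derivative
      (\<lambda>h. frechet_derivative f (at x) h + frechet_derivative g (at x) h)) (at x)"
    using assms by (intro has_derivative_add) (auto simp: frechet_derivative_works)
  then show ?thesis by (subst vec_eq_iff) (auto simp: grad_nth, simp add: grad_def)
qed

lemma grad_mult:
  assumes "f differentiable (at x)" "g differentiable (at x)"
  shows "grad (\<lambda>x. f x * g x) x = f x *\<^sub>R grad g x + g x *\<^sub>R grad f x"
proof -
  have "((\<lambda>x. f x * g x) has_derivative
      (\<lambda>h. f x * frechet_derivative g (at x) h + frechet_derivative f (at x) h * g x)) (at x)"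
    using assms by (intro has_derivative_mult) (auto simp: frechet_derivative_works)
  then show ?thesis by (subst vec_eq_iff) (auto simp: grad_nth, simp add: grad_def)
qed

lemma Ck_add: "Ck k f \<Longrightarrow> Ck k g \<Longrightarrow> Ck k (\<lambda>x. f x + g x)"
proof (induction k arbitrary: f g)
  case (Suc k)
  then show ?case by (simp add: grad_add)
qed (auto intro: continuous_on_add)

lemma Ck_mult: "Ck k f \<Longrightarrow> Ck k g \<Longrightarrow> Ck k (\<lambda>x. f x * g x)"
proof (induction k arbitrary: f g)
  case (Suc k)
  \<comment> \<open>The product rule leaves each factor once undifferentiated, so \<open>f\<close>
    and \<open>g\<close> themselves are needed at order \<open>k\<close>.\<close>
  then have "Ck k f" "Ck k g" by (auto intro: Ck_Suc_imp)
  with Suc show ?case by (auto simp: grad_mult intro!: Ck_add)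
qed (auto intro: continuous_on_mult)

lemma Ck_prod: "finite A \<Longrightarrow> (\<And>i. i \<in> A \<Longrightarrow> Ck k (f i)) \<Longrightarrow> Ck k (\<lambda>x. \<Prod>i\<in>A. f i x)"
  by (induction A rule: finite_induct) (auto intro: Ck_mult)

text \<open>For \<open>m = 0\<close> this is the classical smooth function that vanishes to infinite
  order at 0. Differentiation produces only members of the family with larger \<open>m\<close>, so
  an induction on the order of differentiability closes once \<open>m\<close> is arbitrary.\<close>

definition flat :: "nat \<Rightarrow> real \<Rightarrow> real" where
  "flat m t = (if t > 0 then exp (- 1 / t) / t ^ m else 0)"

lemma flat_tendsto_0: "(flat m \<longlongrightarrow> 0) (at 0)"
proof -
  \<comment> \<open>With s = 1/t this is s^m / exp s as s tends to infinity.\<close>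
  have "((\<lambda>t::real. inverse t ^ m / exp (inverse t)) \<longlongrightarrow> 0) (at_right 0)"
    using filterlim_compose[OF tendsto_power_div_exp_0 filterlim_inverse_at_top_right] .
  then have "(flat m \<longlongrightarrow> 0) (at_right 0)"
    by (rule Lim_transform_eventually)
      (auto simp: flat_def eventually_at_filter exp_minus field_simps)
  moreover have "(flat m \<longlongrightarrow> 0) (at_left 0)"
    by (rule tendsto_eventually) (auto simp: flat_def eventually_at_filter)
  ultimately show ?thesis by (simp add: filterlim_split_at)
qed

lemma flat_DERIV: "(flat m has_real_derivative flat (m + 2) t - m * flat (Suc m) t) (at t)"
proof -
  consider "t > 0" | "t < 0" | "t = 0" by linarith
  then show ?thesis
  proof cases
    case 1
    have "((\<lambda>t. exp (- 1 / t) / t ^ m) has_real_derivative flat (m + 2) t - m * flat (Suc m) t) (at t)"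
    \<comment> \<open>The power rule yields the truncated exponent \<open>m - Suc 0\<close>, which
      is why \<open>m = 0\<close> is treated apart.\<close>
    proof (cases m)
      case 0
      with 1 show ?thesis
        by (auto intro!: derivative_eq_intros simp: flat_def field_simps power2_eq_square)
    next
      case (Suc j)
      have "((\<lambda>t. exp (- 1 / t) / t ^ m) has_real_derivative
          ((exp (- 1 / t) * (1 / t\<^sup>2)) * t ^ m - exp (- 1 / t) * (real m * t ^ (m - Suc 0))) / (t ^ m * t ^ m)) (at t)"
        using 1 by (auto intro!: derivative_eq_intros simp: power2_eq_square)
      moreover have "((exp (- 1 / t) * (1 / t\<^sup>2)) * t ^ m - exp (- 1 / t) * (real m * t ^ (m - Suc 0))) / (t ^ m * t ^ m)
          = flat (m + 2) t - m * flat (Suc m) t"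
        using 1 Suc by (simp add: flat_def field_simps power2_eq_square)
      ultimately show ?thesis by simp
    qed
    then show ?thesis
      by (rule has_field_derivative_transform_within_open[of _ _ _ "{0<..}"]) (use 1 in \<open>auto simp: flat_def\<close>)
  next
    case 2
    have "((\<lambda>t. 0) has_real_derivative flat (m + 2) t - m * flat (Suc m) t) (at t)"
      using 2 by (auto simp: flat_def)
    then show ?thesis
      by (rule has_field_derivative_transform_within_open[of _ _ _ "{..<0}"]) (use 2 in \<open>auto simp: flat_def\<close>)
  next
    case 3
    \<comment> \<open>Division by \<open>h\<close> turns \<open>flat m\<close> into
      \<open>flat (Suc m)\<close>, so the difference quotient at 0 is covered by
      \<open>flat_tendsto_0\<close>.\<close>
    have "((\<lambda>h. flat m h / h) \<longlongrightarrow> 0) (at 0)"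
      using flat_tendsto_0[of "Suc m"]
      by (rule Lim_transform_eventually) (auto simp: flat_def eventually_at_filter)
    then show ?thesis
      using 3 by (simp add: has_field_derivative_iff flat_def[of _ 0])
  qed
qed

text \<open>Affine functions of a single coordinate suffice: the bumps on boxes are products over
  the coordinates.\<close>

lemma Ck_flat: "Ck k (\<lambda>x :: real ^ 'n. flat m (\<alpha> * x $ i + \<beta>))"
proof (induction k arbitrary: m)
  case 0
  have "continuous_on UNIV (flat m)"
    by (intro continuous_at_imp_continuous_on ballI DERIV_isCont[OF flat_DERIV])
  then have "continuous_on UNIV (\<lambda>x :: real ^ 'n. flat m (\<alpha> * x $ i + \<beta>))"
    by (rule continuous_on_compose2[of _ _ _ "\<lambda>x. \<alpha> * x $ i + \<beta>"]) (auto intro!: continuous_intros)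
  then show ?case by simp
next
  case (Suc k)
  have D: "((\<lambda>x :: real ^ 'n. flat m (\<alpha> * x $ i + \<beta>)) has_derivative
      (\<lambda>h. (\<alpha> * h $ i) * (flat (m + 2) (\<alpha> * x $ i + \<beta>) - m * flat (Suc m) (\<alpha> * x $ i + \<beta>)))) (at x)" for x
    by (rule has_derivative_eq_rhs, rule DERIV_compose_FDERIV[OF flat_DERIV])
      (auto intro!: derivative_eq_intros bounded_linear_imp_has_derivative bounded_linear_vec_nth)
  have "Ck k (\<lambda>x. grad (\<lambda>x. flat m (\<alpha> * x $ i + \<beta>)) x $ j)" for j
    unfolding grad_nth[OF D]
    using Ck_mult[OF Ck_const[of k "\<alpha> * axis j (1::real) $ i"] Ck_add[OF Suc[of "m + 2"] Ck_mult[OF Ck_const[of k "- real m"] Suc[of "Suc m"]]]]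
    by simp
  with D show ?case by (auto simp: differentiable_def)
qed

lemma grad_eq_0_outside:
  assumes "compact K" "\<And>x. x \<notin> K \<Longrightarrow> g x = 0" "x \<notin> K"
  shows "grad g x = 0"
proof -
  have "(g has_derivative (\<lambda>h. 0)) (at x)"
  proof (rule has_derivative_transform_within_open[OF has_derivative_const])
    show "open (- K)" "x \<in> - K" using assms compact_imp_closed by auto
    show "0 = g y" if "y \<in> - K" for y using assms(2)[of y] that by auto
  qed
  then show ?thesis by (auto simp: vec_eq_iff grad_nth)
qed

lemma test_funI:
  assumes "\<And>k. Ck k \<phi>" "compact K" "K \<subseteq> \<Omega>" "\<And>x. x \<notin> K \<Longrightarrow> \<phi> x = 0"
  shows "test_fun \<Omega> \<phi>"
proof -
  have "closure {x. \<phi> x \<noteq> 0} \<subseteq> K"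
    using assms by (intro closure_minimal compact_imp_closed) auto
  with assms show ?thesis
    unfolding test_fun_def using compact_Int_closed[of K "closure {x. \<phi> x \<noteq> 0}"] by (auto simp: Int_absorb1)
qed

lemma test_funD:
  assumes "test_fun \<Omega> \<phi>"
  obtains K where "compact K" "K \<subseteq> \<Omega>" "\<And>x. x \<notin> K \<Longrightarrow> \<phi> x = 0" "\<And>x. x \<notin> K \<Longrightarrow> grad \<phi> x = 0"
proof (rule that)
  let ?K = "closure {x. \<phi> x \<noteq> 0}"
  show "compact ?K" "?K \<subseteq> \<Omega>" using assms by (auto simp: test_fun_def)
  show z: "\<phi> x = 0" if "x \<notin> ?K" for x using that closure_subset[of "{x. \<phi> x \<noteq> 0}"] by auto
  show "grad \<phi> x = 0" if "x \<notin> ?K" for x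
    by (rule grad_eq_0_outside[OF \<open>compact ?K\<close> z that])
qed

lemma test_fun_differentiable: "test_fun \<Omega> \<phi> \<Longrightarrow> \<phi> differentiable (at x)"
  using Ck.simps(2)[of 0 \<phi>] by (simp add: test_fun_def del: Ck.simps)

lemma test_fun_continuous: "test_fun \<Omega> \<phi> \<Longrightarrow> continuous_on A \<phi>"
  using Ck_continuous[of 0 \<phi>] continuous_on_subset[of UNIV \<phi> A] by (simp add: test_fun_def del: Ck.simps)

lemma test_fun_continuous_grad: "test_fun \<Omega> \<phi> \<Longrightarrow> continuous_on A (grad \<phi>)"
proof (rule continuous_on_subset[OF _ subset_UNIV])
  assume "test_fun \<Omega> \<phi>"
  then have "Ck (Suc 0) \<phi>" by (simp add: test_fun_def)
  then have "continuous_on UNIV (\<lambda>x. \<chi> i. grad \<phi> x $ i)" by (intro continuous_on_vec_lambda) auto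
  then show "continuous_on UNIV (grad \<phi>)" by simp
qed

lemma test_fun_mult: 
  assumes "test_fun \<Omega> \<phi>" "test_fun \<Omega> \<psi>" shows "test_fun \<Omega> (\<lambda>x. \<phi> x * \<psi> x)"
proof -
  obtain K where "compact K" "K \<subseteq> \<Omega>" "\<And>x. x \<notin> K \<Longrightarrow> \<phi> x = 0" using test_funD[OF assms(1)] by metis
  with assms show ?thesis by (intro test_funI[of _ K]) (auto simp: test_fun_def intro: Ck_mult)
qed

lemma test_fun_diff: 
  assumes "test_fun \<Omega> \<phi>" "test_fun \<Omega> \<psi>" shows "test_fun \<Omega> (\<lambda>x. \<phi> x - \<psi> x)"
proof -
  obtain K where K: "compact K" "K \<subseteq> \<Omega>" "\<And>x. x \<notin> K \<Longrightarrow> \<phi> x = 0" using test_funD[OF assms(1)] by metis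
  obtain L where L: "compact L" "L \<subseteq> \<Omega>" "\<And>x. x \<notin> L \<Longrightarrow> \<psi> x = 0" using test_funD[OF assms(2)] by metis
  have "Ck k (\<lambda>x. \<phi> x + (-1) * \<psi> x)" for k
    using assms by (intro Ck_add Ck_mult) (auto simp: test_fun_def)
  with K L show ?thesis by (intro test_funI[of _ "K \<union> L"]) auto
qed

lemma grad_diff:
  assumes "f differentiable (at x)" "g differentiable (at x)"
  shows "grad (\<lambda>x. f x - g x) x = grad f x - grad g x"
proof -
  have "((\<lambda>x. f x - g x) has_derivative
      (\<lambda>h. frechet_derivative f (at x) h - frechet_derivative g (at x) h)) (at x)"
    using assms by (intro has_derivative_diff) (auto simp: frechet_derivative_works)
  then show ?thesis by (subst vec_eq_iff) (auto simp: grad_nth, simp add: grad_def)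
qed

text \<open>Each coordinate contributes exp (-1/s) for s equal to \<open>k + 1\<close> times the
  distance to either face. The factors vanish on and beyond the faces, stay in [0,1], and tend to 1
  inside because s tends to infinity. The limit is therefore the indicator of the open box.\<close>

lemma box_bump:
  fixes c d :: "real ^ 'n"
  assumes "cbox c d \<subseteq> \<Omega>"
  obtains b :: "nat \<Rightarrow> real ^ 'n \<Rightarrow> real" where
    "\<And>k. test_fun \<Omega> (b k)" "\<And>k x. 0 \<le> b k x" "\<And>k x. b k x \<le> indicator (box c d) x"
    "\<And>x. (\<lambda>k. b k x) \<longlonglongrightarrow> indicator (box c d) x"
proof (rule that)
  define b where "b k x = (\<Prod>i\<in>UNIV. flat 0 (real (Suc k) * x $ i + - real (Suc k) * c $ i) *
     flat 0 (- real (Suc k) * x $ i + real (Suc k) * d $ i))" for k and x :: "real ^ 'n"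
  have flat01: "0 \<le> flat 0 t" "flat 0 t \<le> 1" for t by (auto simp: flat_def)
  have z: "b k x = 0" if x: "x \<notin> box c d" for k x
  proof -
    obtain i where i: "x $ i \<le> c $ i \<or> d $ i \<le> x $ i" using x by (auto simp: mem_box_cart not_less)
    then have "real (Suc k) * x $ i \<le> real (Suc k) * c $ i \<or> real (Suc k) * d $ i \<le> real (Suc k) * x $ i"
      using mult_left_mono[of _ _ "real (Suc k)"] by (meson of_nat_0_le_iff)
    then show ?thesis unfolding b_def by (intro prod_zero bexI[of _ i]) (auto simp: flat_def simp del: of_nat_Suc)
  qed
  show "test_fun \<Omega> (b k)" for k
  proof (rule test_funI[of _ "cbox c d"])
    show "Ck j (b k)" for j unfolding b_def by (intro Ck_prod Ck_mult Ck_flat) auto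
    show "b k x = 0" if "x \<notin> cbox c d" for x using that z box_subset_cbox[of c d] by auto
  qed (use assms in auto)
  show "0 \<le> b k x" for k x unfolding b_def by (intro prod_nonneg) (auto simp: flat01)
  show "b k x \<le> indicator (box c d) x" for k x
  proof (cases "x \<in> box c d")
    case True
    have "b k x \<le> 1" unfolding b_def by (intro prod_le_1) (auto simp: flat01 intro!: mult_le_one)
    with True show ?thesis by simp
  qed (simp add: z)
  show "(\<lambda>k. b k x) \<longlonglongrightarrow> indicator (box c d) x" for x
  proof (cases "x \<in> box c d")
    case True
    have lim: "(\<lambda>k. flat 0 (real (Suc k) * t)) \<longlonglongrightarrow> 1" if "t > 0" for t
    proof -
      have "(\<lambda>k. exp (- inverse t * inverse (real (Suc k)))) \<longlonglongrightarrow> exp (- inverse t * 0)"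
        by (intro tendsto_intros LIMSEQ_inverse_real_of_nat)
      moreover have "0 < real (Suc k) * t" for k using that by simp
      ultimately show ?thesis by (simp add: flat_def field_simps del: of_nat_Suc)
    qed
    have "(\<lambda>k. \<Prod>i\<in>UNIV. flat 0 (real (Suc k) * (x $ i - c $ i)) * flat 0 (real (Suc k) * (d $ i - x $ i)))
        \<longlonglongrightarrow> (\<Prod>i\<in>(UNIV::'n set). 1 * 1)"
      using True by (intro tendsto_intros lim) (auto simp: mem_box_cart)
    then show ?thesis using True by (simp add: b_def algebra_simps del: of_nat_Suc)
  qed (simp add: z)
qed

section \<open>The fundamental lemma and weak gradients\<close>

lemma integrable_dominated:
  fixes f :: "'a \<Rightarrow> 'b::{banach, second_countable_topology}"
    and g :: "'a \<Rightarrow> 'c::{banach, second_countable_topology}"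
  assumes "integrable M f" "g \<in> borel_measurable M" "AE x in M. norm (g x) \<le> C * norm (f x)"
  shows "integrable M g"
proof (rule Bochner_Integration.integrable_bound[OF _ assms(2)])
  show "integrable M (\<lambda>x. C * norm (f x))" using assms(1) by auto
  show "AE x in M. norm (g x) \<le> norm (C * norm (f x))" using assms(3) by eventually_elim auto
qed

lemma continuous_lebesgue_measurable:
  fixes g :: "'a::euclidean_space \<Rightarrow> 'b::topological_space"
  shows "continuous_on UNIV g \<Longrightarrow> g \<in> borel_measurable lebesgue"
  by (intro measurable_completion) (simp add: borel_measurable_continuous_onI)

lemma set_integrable_lebesgue_on:
  fixes f :: "'a::euclidean_space \<Rightarrow> 'b::euclidean_space"
  assumes "S \<in> sets lebesgue"
  shows "set_integrable lebesgue S f \<longleftrightarrow> integrable (lebesgue_on S) f"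
  using assms by (simp add: set_integrable_def integrable_restrict_space)

lemma locally_integrable_compact:
  assumes "locally_integrable \<Omega> h" "compact K" "K \<subseteq> \<Omega>"
  shows "integrable lebesgue (\<lambda>x. indicator K x *\<^sub>R h x)"
  using assms set_integrable_lebesgue_on[of K h] by (auto simp: locally_integrable_def set_integrable_def lmeasurable_compact fmeasurableD)

lemma locally_integrable_mult:
  fixes h g :: "real ^ 'n \<Rightarrow> real"
  assumes "open \<Omega>" "locally_integrable \<Omega> h" "continuous_on UNIV g" "compact K" "K \<subseteq> \<Omega>" "\<And>x. x \<notin> K \<Longrightarrow> g x = 0"
  shows "integrable (lebesgue_on \<Omega>) (\<lambda>x. h x * g x)"
proof -
  have "bounded (g ` K)"
    using assms by (intro compact_imp_bounded compact_continuous_image continuous_on_subset[OF assms(3)]) auto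
  then obtain C where C: "\<And>x. x \<in> K \<Longrightarrow> \<bar>g x\<bar> \<le> C" by (force simp: bounded_iff)
  have g: "g \<in> borel_measurable lebesgue"
    by (rule continuous_lebesgue_measurable[OF assms(3)])
  have I: "integrable lebesgue (\<lambda>x. indicator K x *\<^sub>R h x)" by (rule locally_integrable_compact[OF assms(2,4,5)])
  then have "integrable lebesgue (\<lambda>x. (indicator K x *\<^sub>R h x) * g x)"
  proof (rule integrable_dominated)
    show "(\<lambda>x. indicat_real K x *\<^sub>R h x * g x) \<in> borel_measurable lebesgue" using I g by measurable
    show "AE x in lebesgue. norm (indicat_real K x *\<^sub>R h x * g x) \<le> C * norm (indicat_real K x *\<^sub>R h x)"
      using C by (auto simp: indicator_def abs_mult mult.commute intro!: mult_right_mono)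
  qed
  moreover have "(\<lambda>x. (indicator K x *\<^sub>R h x) * g x) = (\<lambda>x. indicator \<Omega> x *\<^sub>R (h x * g x))"
  proof
    show "(indicator K x *\<^sub>R h x) * g x = indicator \<Omega> x *\<^sub>R (h x * g x)" for x
      using assms(5,6) by (cases "x \<in> K") auto
  qed
  ultimately show ?thesis using assms(1) by (simp add: integrable_restrict_space)
qed

lemma locally_integrable_nth: "locally_integrable \<Omega> G \<Longrightarrow> locally_integrable \<Omega> (\<lambda>x. G x $ i)"
  unfolding locally_integrable_def using integrable_bounded_linear[OF bounded_linear_vec_nth] by blast

lemma locally_integrable_test_fun:
  assumes "open \<Omega>" "locally_integrable \<Omega> h" "test_fun \<Omega> \<phi>"
  shows "integrable (lebesgue_on \<Omega>) (\<lambda>x. h x * \<phi> x)" "integrable (lebesgue_on \<Omega>) (\<lambda>x. h x * grad \<phi> x $ i)"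
proof -
  obtain K where K: "compact K" "K \<subseteq> \<Omega>" "\<And>x. x \<notin> K \<Longrightarrow> \<phi> x = 0" "\<And>x. x \<notin> K \<Longrightarrow> grad \<phi> x = 0"
    using test_funD[OF assms(3)] by metis
  show "integrable (lebesgue_on \<Omega>) (\<lambda>x. h x * \<phi> x)"
    by (rule locally_integrable_mult[OF assms(1,2) test_fun_continuous[OF assms(3)] K(1-3)])
  have "continuous_on UNIV (\<lambda>x. grad \<phi> x $ i)"
    using test_fun_continuous_grad[OF assms(3)] by (intro continuous_intros)
  then show "integrable (lebesgue_on \<Omega>) (\<lambda>x. h x * grad \<phi> x $ i)"
    by (rule locally_integrable_mult[OF assms(1,2) _ K(1,2)]) (simp add: K(4))
qed

text \<open>The bumps of \<open>box_bump\<close> are admissible in \<open>pos\<close>, and dominated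
  convergence with majorant |h| on the compact box replaces them by the indicator of the open box.
  Its faces are null, so the closed box has the same integral.\<close>

lemma integral_cbox_nonneg:
  fixes h :: "real ^ 'n \<Rightarrow> real"
  assumes "open \<Omega>" "locally_integrable \<Omega> h"
    and pos: "\<And>\<phi>. test_fun \<Omega> \<phi> \<Longrightarrow> (\<And>x. 0 \<le> \<phi> x) \<Longrightarrow> 0 \<le> (LINT x|lebesgue_on \<Omega>. h x * \<phi> x)"
    and "cbox c d \<subseteq> \<Omega>"
  shows "0 \<le> integral (cbox c d) h"
proof -
  obtain b :: "nat \<Rightarrow> real ^ 'n \<Rightarrow> real" where b: "\<And>k. test_fun \<Omega> (b k)" "\<And>k x. 0 \<le> b k x"
    "\<And>k x. b k x \<le> indicator (box c d) x" "\<And>x. (\<lambda>k. b k x) \<longlonglongrightarrow> indicator (box c d) x"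
    using box_bump[OF assms(4)] by metis
  have z: "b k x = 0" if "x \<notin> box c d" for k x
    using b(2,3)[of k x] that by simp
  have bl: "\<bar>b k x\<bar> \<le> 1" for k x
    using b(2,3)[of k x] indicator_le_1[of "box c d" x] by (smt (verit))
  have bm: "b k \<in> borel_measurable lebesgue" for k
    by (rule continuous_lebesgue_measurable[OF test_fun_continuous[OF b(1)]])
  have I: "integrable lebesgue (\<lambda>x. indicator (cbox c d) x *\<^sub>R h x)"
    by (rule locally_integrable_compact[OF assms(2) _ assms(4)]) simp
  have lim: "(\<lambda>k. LINT x|lebesgue. (indicator (cbox c d) x *\<^sub>R h x) * b k x) \<longlonglongrightarrow>
      (LINT x|lebesgue. (indicator (cbox c d) x *\<^sub>R h x) * indicator (box c d) x)"
  proof (rule integral_dominated_convergence)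
    show "integrable lebesgue (\<lambda>x. norm (indicator (cbox c d) x *\<^sub>R h x))" using I by auto
    show "(\<lambda>x. indicat_real (cbox c d) x *\<^sub>R h x * indicat_real (box c d) x) \<in> borel_measurable lebesgue"
      by (intro borel_measurable_times borel_measurable_indicator borel_measurable_integrable[OF I]) simp
    show "(\<lambda>x. indicat_real (cbox c d) x *\<^sub>R h x * b k x) \<in> borel_measurable lebesgue" for k
      using I bm by measurable
    show "AE x in lebesgue. (\<lambda>k. indicat_real (cbox c d) x *\<^sub>R h x * b k x)
         \<longlonglongrightarrow> indicat_real (cbox c d) x *\<^sub>R h x * indicat_real (box c d) x"
      by (intro AE_I2 tendsto_intros b)
    show "AE x in lebesgue. norm (indicat_real (cbox c d) x *\<^sub>R h x * b k x)
         \<le> norm (indicat_real (cbox c d) x *\<^sub>R h x)" for k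
      using bl by (intro AE_I2) (simp add: abs_mult mult_left_le)
  qed
  have "(LINT x|lebesgue. (indicator (cbox c d) x *\<^sub>R h x) * b k x) = (LINT x|lebesgue_on \<Omega>. h x * b k x)" for k
  proof -
    have "(LINT x|lebesgue_on \<Omega>. h x * b k x) = (LINT x|lebesgue. indicator \<Omega> x *\<^sub>R (h x * b k x))"
      using assms(1) by (intro integral_restrict_space) simp
    also have "(\<lambda>x. indicator \<Omega> x *\<^sub>R (h x * b k x)) = (\<lambda>x. (indicator (cbox c d) x *\<^sub>R h x) * b k x)"
    proof
      show "indicator \<Omega> x *\<^sub>R (h x * b k x) = (indicator (cbox c d) x *\<^sub>R h x) * b k x" for x
        using z[of x k] subsetD[OF assms(4), of x] subsetD[OF box_subset_cbox[of c d], of x]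
        by (cases "x \<in> box c d") auto
    qed
    finally show ?thesis by simp
  qed
  then have "0 \<le> (LINT x|lebesgue. (indicator (cbox c d) x *\<^sub>R h x) * b k x)" for k
    using pos[OF b(1)[of k] b(2)] by simp
  with lim have "0 \<le> (LINT x|lebesgue. (indicator (cbox c d) x *\<^sub>R h x) * indicator (box c d) x)"
    by (intro LIMSEQ_le_const) auto
  also have "\<dots> = (LINT x:box c d|lebesgue. h x)"
    unfolding set_lebesgue_integral_def
    by (intro Bochner_Integration.integral_cong) (use box_subset_cbox[of c d] in \<open>auto simp: indicator_def\<close>)
  also have "\<dots> = integral (box c d) h"
  proof (rule set_lebesgue_integral_eq_integral)
    show "set_integrable lebesgue (box c d) h"
      by (rule set_integrable_subset[of _ "cbox c d"]) (use I box_subset_cbox[of c d] in \<open>auto simp: set_integrable_def\<close>)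
  qed
  finally show ?thesis by (simp add: integral_open_interval)
qed

text \<open>Positivity on cubes suffices by Lebesgue differentiation along cubes.\<close>

lemma AE_nonneg_if_test_fun_nonneg:
  fixes h :: "real ^ 'n \<Rightarrow> real"
  assumes "open \<Omega>" "locally_integrable \<Omega> h"
    and pos: "\<And>\<phi>. test_fun \<Omega> \<phi> \<Longrightarrow> (\<And>x. 0 \<le> \<phi> x) \<Longrightarrow> 0 \<le> (LINT x|lebesgue_on \<Omega>. h x * \<phi> x)"
  shows "AE x in lebesgue_on \<Omega>. 0 \<le> h x"
proof -
  have cube: "AE x in lebesgue. x \<in> cbox c d \<longrightarrow> 0 \<le> h x" if cd: "cbox c d \<subseteq> \<Omega>" for c d
  proof -
    \<comment> \<open>The differentiation theorem asks for integrability over every box, so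
      \<open>h\<close> is cut off outside the given one.\<close>
    define f where "f x = indicator (cbox c d) x *\<^sub>R h x" for x
    have "f absolutely_integrable_on UNIV"
      using locally_integrable_compact[OF assms(2) compact_cbox cd] by (simp add: f_def[abs_def] set_integrable_def)
    then have "f integrable_on cbox a b" for a b
      using set_lebesgue_integral_eq_integral(1) set_integrable_subset[of lebesgue UNIV f "cbox a b"] by auto
    \<comment> \<open>Lebesgue differentiation along cubes whose lower corner is the point: off
      \<open>N\<close> their averages tend to \<open>f x\<close>. A negative value of
      \<open>h\<close> would make small averages negative.\<close>
    then obtain N where N: "negligible N" "\<And>x e. \<lbrakk>x \<notin> N; 0 < e\<rbrakk> \<Longrightarrow>
         \<exists>d>0. \<forall>h. 0 < h \<and> h < d \<longrightarrow> norm (integral (cbox x (x + h *\<^sub>R One)) f /\<^sub>R h ^ DIM(real ^ 'n) - f x) < e"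
      using integrable_ccontinuous_explicit[of f] by metis
    have h: "0 \<le> h x" if x: "x \<in> box c d" "x \<notin> N" for x
    proof (rule ccontr)
      assume neg: "\<not> 0 \<le> h x"
      have fx: "f x = h x" using x box_subset_cbox[of c d] by (auto simp: f_def)
      obtain \<delta> where \<delta>: "\<delta> > 0" "\<And>t. 0 < t \<and> t < \<delta> \<Longrightarrow>
          norm (integral (cbox x (x + t *\<^sub>R One)) f /\<^sub>R t ^ DIM(real ^ 'n) - f x) < - h x"
        using N(2)[OF x(2), of "- h x"] neg by auto
      obtain r where r: "r > 0" "ball x r \<subseteq> box c d"
        using x(1) open_box openE by metis
      \<comment> \<open>The first bound brings the average within \<open>- h x\<close> of
        \<open>f x\<close>; the second keeps the diagonal \<open>t * norm One\<close> below
        \<open>r\<close>, so the cube stays inside the box.\<close>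
      define t where "t = min (\<delta> / 2) (r / (2 * norm (One :: real ^ 'n)))"
      have One: "norm (One :: real ^ 'n) > 0" by simp
      have t: "0 < t" "t < \<delta>" "t * norm (One :: real ^ 'n) < r"
        using \<delta>(1) r(1) One by (auto simp: t_def min_def field_simps)
      have "cbox x (x + t *\<^sub>R One) \<subseteq> ball x r"
      proof
        fix y assume "y \<in> cbox x (x + t *\<^sub>R One)"
        then have "norm (y - x) \<le> norm (t *\<^sub>R One :: real ^ 'n)"
          using t(1) by (intro norm_le_componentwise) (auto simp: mem_box inner_diff_left inner_add_left algebra_simps)
        with t show "y \<in> ball x r" by (simp add: dist_norm norm_minus_commute)
      qed
      then have sub: "cbox x (x + t *\<^sub>R One) \<subseteq> cbox c d" using r box_subset_cbox[of c d] by blast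
      then have "integral (cbox x (x + t *\<^sub>R One)) f = integral (cbox x (x + t *\<^sub>R One)) h"
        by (intro integral_cong) (auto simp: f_def)
      moreover have "0 \<le> integral (cbox x (x + t *\<^sub>R One)) h"
        using integral_cbox_nonneg[OF assms, of x "x + t *\<^sub>R One"] sub cd by blast
      ultimately have "0 \<le> integral (cbox x (x + t *\<^sub>R One)) f /\<^sub>R t ^ DIM(real ^ 'n)"
        using t(1) by simp
      then show False using \<delta>(2)[of t] t fx neg by auto
    qed
    have "negligible (N \<union> (cbox c d - box c d))" using N negligible_frontier_interval by (intro negligible_Un) auto
    then have "N \<union> (cbox c d - box c d) \<in> null_sets lebesgue" by (simp add: negligible_iff_null_sets)
    then show ?thesis by (rule AE_I') (use h in auto)
  qed
  obtain \<D> where D: "countable \<D>" "\<D> \<subseteq> Pow \<Omega>" "\<And>X. X \<in> \<D> \<Longrightarrow> \<exists>a b. X = cbox a b" "\<Union>\<D> = \<Omega>"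
    using open_countable_Union_open_cbox[OF assms(1)] by metis
  have "AE x in lebesgue. \<forall>X\<in>\<D>. x \<in> X \<longrightarrow> 0 \<le> h x"
    unfolding AE_ball_countable[OF D(1)]
  proof
    fix X assume X: "X \<in> \<D>"
    then obtain a b where "X = cbox a b" using D(3) by blast
    with X D(2) show "AE x in lebesgue. x \<in> X \<longrightarrow> 0 \<le> h x" using cube[of a b] by blast
  qed
  then have "AE x in lebesgue. x \<in> \<Omega> \<longrightarrow> 0 \<le> h x"
    by eventually_elim (use D(4) in auto)
  then show ?thesis using assms(1) by (simp add: AE_restrict_space_iff)
qed

text \<open>Each component of \<open>G - H\<close> integrates to 0 against every test function, so
  the fundamental lemma applies to it with both signs.\<close>

lemma is_weak_grad_unique:
  assumes "open \<Omega>" "is_weak_grad \<Omega> u G" "is_weak_grad \<Omega> u H"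
  shows "AE x in lebesgue_on \<Omega>. G x = H x"
proof -
  have *: "AE x in lebesgue_on \<Omega>. 0 \<le> G x $ i - H x $ i"
    if "is_weak_grad \<Omega> u G" "is_weak_grad \<Omega> u H" for G H i
  proof (rule AE_nonneg_if_test_fun_nonneg[OF assms(1)])
    have L: "locally_integrable \<Omega> (\<lambda>x. G x $ i)" "locally_integrable \<Omega> (\<lambda>x. H x $ i)"
      using that by (auto simp: is_weak_grad_def intro: locally_integrable_nth)
    then show "locally_integrable \<Omega> (\<lambda>x. G x $ i - H x $ i)" by (auto simp: locally_integrable_def)
    show "0 \<le> (LINT x|lebesgue_on \<Omega>. (G x $ i - H x $ i) * \<phi> x)" if t: "test_fun \<Omega> \<phi>" for \<phi>
      using that locally_integrable_test_fun(1)[OF assms(1) L(1) t] locally_integrable_test_fun(1)[OF assms(1) L(2) t]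
        \<open>is_weak_grad \<Omega> u G\<close> \<open>is_weak_grad \<Omega> u H\<close>
      by (simp add: is_weak_grad_def left_diff_distrib)
  qed
  have "AE x in lebesgue_on \<Omega>. \<forall>i\<in>UNIV. 0 \<le> G x $ i - H x $ i \<and> 0 \<le> H x $ i - G x $ i"
    by (rule AE_finite_allI) (use *[OF assms(2,3)] *[OF assms(3,2)] in auto)
  then show ?thesis by eventually_elim (auto simp: vec_eq_iff intro: antisym)
qed

lemma is_weak_grad_wgrad: "is_weak_grad \<Omega> u G \<Longrightarrow> is_weak_grad \<Omega> u (wgrad \<Omega> u)"
  unfolding wgrad_def by (rule someI[of "is_weak_grad \<Omega> u"])

lemma is_weak_grad_diff:
  assumes "open \<Omega>" "is_weak_grad \<Omega> u G" "is_weak_grad \<Omega> v H"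
  shows "is_weak_grad \<Omega> (\<lambda>x. u x - v x) (\<lambda>x. G x - H x)"
proof -
  have L: "locally_integrable \<Omega> u" "locally_integrable \<Omega> v" "locally_integrable \<Omega> G" "locally_integrable \<Omega> H"
    using assms by (auto simp: is_weak_grad_def)
  show ?thesis unfolding is_weak_grad_def
  proof (intro conjI allI impI)
    show "locally_integrable \<Omega> (\<lambda>x. u x - v x)" "locally_integrable \<Omega> (\<lambda>x. G x - H x)"
      using L by (auto simp: locally_integrable_def)
    fix \<phi> i assume t: "test_fun \<Omega> \<phi>"
    show "(LINT x|lebesgue_on \<Omega>. (u x - v x) * grad \<phi> x $ i) = - (LINT x|lebesgue_on \<Omega>. (G x - H x) $ i * \<phi> x)"
      using locally_integrable_test_fun(2)[OF assms(1) L(1) t, of i] locally_integrable_test_fun(2)[OF assms(1) L(2) t, of i]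
        locally_integrable_test_fun(1)[OF assms(1) locally_integrable_nth[OF L(3)] t, of i]
        locally_integrable_test_fun(1)[OF assms(1) locally_integrable_nth[OF L(4)] t, of i] assms(2,3) t
      by (simp add: left_diff_distrib is_weak_grad_def)
  qed
qed

lemma locally_integrable_scaleR:
  fixes h :: "real ^ 'n \<Rightarrow> real" and g :: "real ^ 'n \<Rightarrow> 'b::euclidean_space"
  assumes "continuous_on UNIV h" "locally_integrable \<Omega> g"
  shows "locally_integrable \<Omega> (\<lambda>x. h x *\<^sub>R g x)"
  unfolding locally_integrable_def
proof (intro allI impI)
  fix K assume K: "compact K \<and> K \<subseteq> \<Omega>"
  then have I: "integrable (lebesgue_on K) g" using assms by (simp add: locally_integrable_def)
  have "bounded (h ` K)"
    using K assms by (intro compact_imp_bounded compact_continuous_image continuous_on_subset[OF assms(1)]) auto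
  then obtain C where C: "\<And>x. x \<in> K \<Longrightarrow> \<bar>h x\<bar> \<le> C" by (force simp: bounded_iff)
  have "h \<in> borel_measurable lebesgue"
    by (rule continuous_lebesgue_measurable[OF assms(1)])
  then have "h \<in> borel_measurable (lebesgue_on K)" by (rule measurable_restrict_space1)
  with I show "integrable (lebesgue_on K) (\<lambda>x. h x *\<^sub>R g x)"
    by (intro integrable_dominated[OF I, of _ C] AE_I2) (auto simp: space_restrict_space intro!: mult_right_mono C)
qed

lemma continuous_locally_integrable:
  fixes g :: "real ^ 'n \<Rightarrow> 'b::euclidean_space"
  assumes "continuous_on UNIV g" shows "locally_integrable \<Omega> g"
  unfolding locally_integrable_def
proof (intro allI impI)
  fix K assume K: "compact K \<and> K \<subseteq> \<Omega>"
  then have "integrable lborel (\<lambda>x. indicator K x *\<^sub>R g x)"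
    using assms by (intro borel_integrable_compact) (auto intro: continuous_on_subset)
  then have "set_integrable lebesgue K g"
    unfolding set_integrable_def by (subst integrable_completion) (auto dest: borel_measurable_integrable)
  then show "integrable (lebesgue_on K) g"
    using K by (simp add: set_integrable_lebesgue_on lmeasurable_compact fmeasurableD)
qed

section \<open>Integration by parts\<close>

lemma integrable_continuous_compact_support:
  fixes g :: "'a::euclidean_space \<Rightarrow> 'b::euclidean_space"
  assumes "continuous_on UNIV g" "compact K" "\<And>x. x \<notin> K \<Longrightarrow> g x = 0"
  shows "integrable lebesgue g" "integrable lborel g"
proof -
  have "integrable lborel (\<lambda>x. indicator K x *\<^sub>R g x)"
    using assms by (intro borel_integrable_compact) (auto intro: continuous_on_subset)
  also have "(\<lambda>x. indicator K x *\<^sub>R g x) = g"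
    using assms(3) by (force simp: indicator_def)
  finally show "integrable lborel g" .
  then show "integrable lebesgue g"
    by (subst integrable_completion) (auto dest: borel_measurable_integrable)
qed

lemma integral_translation:
  fixes g :: "real ^ 'n \<Rightarrow> real"
  assumes "continuous_on UNIV g"
  shows "(LINT x|lebesgue. g (x + c)) = (LINT x|lebesgue. g x)"
proof -
  have [measurable]: "g \<in> borel_measurable borel" using assms by (rule borel_measurable_continuous_onI)
  have "(LINT x|lborel. g x) = (LINT x|distr lborel borel ((+) c). g x)"
    by (simp add: lborel_distr_plus)
  also have "\<dots> = (LINT x|lborel. g (c + x))"
    by (subst integral_distr) auto
  finally show ?thesis
    by (simp add: integral_completion add.commute)
qed

lemma DERIV_along_axis:
  assumes "\<And>y. g differentiable (at y)"
  shows "((\<lambda>s. g (x + s *\<^sub>R axis i 1)) has_real_derivative grad g (x + s *\<^sub>R axis i 1) $ i) (at s)"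
proof -
  let ?y = "x + s *\<^sub>R axis i 1"
  have g: "(g has_derivative frechet_derivative g (at ?y)) (at ?y)"
    using assms by (simp add: frechet_derivative_works)
  have "((\<lambda>s. x + s *\<^sub>R axis i 1) has_derivative (\<lambda>h. h *\<^sub>R axis i 1)) (at s)"
    by (auto intro!: derivative_eq_intros)
  from has_derivative_compose[OF this g]
  have "((\<lambda>s. g (x + s *\<^sub>R axis i 1)) has_derivative (\<lambda>h. frechet_derivative g (at ?y) (h *\<^sub>R axis i 1))) (at s)" .
  then show ?thesis
    by (simp add: has_field_derivative_def grad_def linear_cmul[OF has_derivative_linear[OF g]] mult.commute[of _ "frechet_derivative g (at ?y) (axis i 1)"])
qed

text \<open>The partial derivative is a dominated limit of difference quotients, whose integrals vanish
  by translation invariance.\<close>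

lemma integral_grad_eq_0:
  fixes g :: "real ^ 'n \<Rightarrow> real"
  assumes diff: "\<And>x. g differentiable (at x)" and cont: "continuous_on UNIV (\<lambda>x. grad g x $ i)"
    and K: "compact K" "\<And>x. x \<notin> K \<Longrightarrow> g x = 0"
  shows "(LINT x|lebesgue. grad g x $ i) = 0"
proof -
  define e :: "real ^ 'n" where "e = axis i 1"
  have [simp]: "norm e = 1" by (simp add: e_def norm_axis_1)
  define t where "t k = inverse (real (Suc k))" for k
  have t: "0 < t k" "t k \<le> 1" for k by (auto simp: t_def divide_simps)
  have cg: "continuous_on UNIV g"
    by (intro continuous_at_imp_continuous_on ballI differentiable_imp_continuous_within diff)
  have z: "grad g x = 0" if "x \<notin> K" for x using grad_eq_0_outside[OF K that] .
  have "bounded ((\<lambda>x. grad g x $ i) ` K)"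
    using K cont by (intro compact_imp_bounded compact_continuous_image continuous_on_subset[OF cont]) auto
  then obtain C where C: "C > 0" "\<And>x. x \<in> K \<Longrightarrow> \<bar>grad g x $ i\<bar> \<le> C" by (force simp: bounded_pos)
  then have C': "\<bar>grad g x $ i\<bar> \<le> C" for x using z[of x] by (cases "x \<in> K") auto
  obtain R where R: "K \<subseteq> cball 0 R" using compact_imp_bounded[OF K(1)] by (auto simp: bounded_iff subset_iff)
  define q where "q k x = (g (x + t k *\<^sub>R e) - g x) / t k" for k x
  have cq: "continuous_on UNIV (q k)" for k
    unfolding q_def using t(1)[of k] cg
    by (intro continuous_intros continuous_on_compose2[OF cg]) auto
  have gI: "integrable lebesgue g" by (rule integrable_continuous_compact_support[OF cg K])
  have gI': "integrable lebesgue (\<lambda>x. g (x + c))" for c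
  proof (rule integrable_continuous_compact_support)
    show "continuous_on UNIV (\<lambda>x. g (x + c))" by (rule continuous_on_compose2[OF cg]) (auto intro!: continuous_intros)
    show "compact ((\<lambda>x. x - c) ` K)" by (intro compact_continuous_image K continuous_intros)
    show "g (x + c) = 0" if "x \<notin> (\<lambda>x. x - c) ` K" for x
      using that K(2)[of "x + c"] by (metis add_diff_cancel_right' imageI)
  qed
  have q0: "(LINT x|lebesgue. q k x) = 0" for k
    unfolding q_def using gI gI' by (simp add: integral_translation[OF cg])
  \<comment> \<open>By the mean value theorem a difference quotient is a value of the partial
    derivative, hence at most \<open>C\<close>. As the increments are at most 1, enlarging the
    radius \<open>R\<close> of the support by 1 contains all the quotients.\<close>
  have qb: "\<bar>q k x\<bar> \<le> indicator (cball 0 (R + 1)) x * C" for k x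
  proof (cases "x \<in> cball 0 (R + 1)")
    case True
    have "\<exists>z. 0 < z \<and> z < t k \<and> g (x + t k *\<^sub>R e) - g (x + 0 *\<^sub>R e) = (t k - 0) * (grad g (x + z *\<^sub>R e) $ i)"
      using t(1)[of k] DERIV_along_axis[OF diff, of _ i] unfolding e_def by (intro MVT2) auto
    then obtain z where "g (x + t k *\<^sub>R e) - g x = t k * (grad g (x + z *\<^sub>R e) $ i)" by auto
    then have "q k x = grad g (x + z *\<^sub>R e) $ i" using t(1)[of k] by (simp add: q_def)
    with True C' show ?thesis by simp
  next
    case False
    have "norm x \<le> norm (x + t k *\<^sub>R e) + norm (t k *\<^sub>R e)"
      using norm_triangle_ineq4[of "x + t k *\<^sub>R e" "t k *\<^sub>R e"] by simp
    with False t[of k] have "x \<notin> cball 0 R" "x + t k *\<^sub>R e \<notin> cball 0 R" by auto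
    with R have "g x = 0" "g (x + t k *\<^sub>R e) = 0" using K(2) by blast+
    with False show ?thesis by (simp add: q_def)
  qed
  have "(\<lambda>k. LINT x|lebesgue. q k x) \<longlonglongrightarrow> (LINT x|lebesgue. grad g x $ i)"
  proof (rule integral_dominated_convergence)
    show "integrable lebesgue (\<lambda>x :: real ^ 'n. indicator (cball 0 (R + 1)) x * C)"
      by (intro integrable_mult_left integrable_real_indicator) (use emeasure_lborel_cball_finite[of "0 :: real ^ 'n" "R + 1"] in \<open>auto simp: top.not_eq_extremum\<close>)
    show "(\<lambda>x. grad g x $ i) \<in> borel_measurable lebesgue" by (rule continuous_lebesgue_measurable[OF cont])
    show "q k \<in> borel_measurable lebesgue" for k by (rule continuous_lebesgue_measurable[OF cq])
    show "AE x in lebesgue. norm (q k x) \<le> indicator (cball 0 (R + 1)) x * C" for k using qb by auto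
    show "AE x in lebesgue. (\<lambda>k. q k x) \<longlonglongrightarrow> grad g x $ i"
    proof (rule AE_I2)
      fix x
      have "((\<lambda>s. (g (x + s *\<^sub>R e) - g x) / s) \<longlongrightarrow> grad g x $ i) (at 0)"
        using DERIV_along_axis[OF diff, of x i 0] by (simp add: has_field_derivative_iff e_def)
      moreover have "filterlim t (at 0) sequentially"
        unfolding filterlim_at using LIMSEQ_inverse_real_of_nat by (auto simp: t_def[abs_def])
      ultimately show "(\<lambda>k. q k x) \<longlonglongrightarrow> grad g x $ i"
        unfolding q_def by (rule filterlim_compose)
    qed
  qed
  then show ?thesis by (simp add: q0 LIMSEQ_const_iff)
qed

lemma lebesgue_integral_on_eq:
  fixes f :: "'a::euclidean_space \<Rightarrow> 'b::euclidean_space"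
  assumes "open \<Omega>" "\<And>x. x \<notin> \<Omega> \<Longrightarrow> f x = 0"
  shows "(LINT x|lebesgue_on \<Omega>. f x) = (LINT x|lebesgue. f x)"
proof -
  have "(LINT x|lebesgue_on \<Omega>. f x) = (LINT x|lebesgue. indicator \<Omega> x *\<^sub>R f x)"
    using assms(1) by (intro integral_restrict_space) simp
  also have "\<dots> = (LINT x|lebesgue. f x)"
    by (intro Bochner_Integration.integral_cong) (use assms(2) in \<open>auto simp: indicator_def\<close>)
  finally show ?thesis .
qed

text \<open>The product \<phi>\<psi> is compactly supported, so the integral of its partial
  derivative vanishes, and the product rule splits this into the two sides.\<close>

lemma is_weak_grad_test_fun:
  assumes "open \<Omega>" "test_fun \<Omega> \<phi>"
  shows "is_weak_grad \<Omega> \<phi> (grad \<phi>)"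
  unfolding is_weak_grad_def
proof (intro conjI allI impI)
  show L: "locally_integrable \<Omega> \<phi>" "locally_integrable \<Omega> (grad \<phi>)"
    using test_fun_continuous[OF assms(2)] test_fun_continuous_grad[OF assms(2)]
    by (auto intro: continuous_locally_integrable)
  fix \<psi> i assume \<psi>: "test_fun \<Omega> \<psi>"
  have t: "test_fun \<Omega> (\<lambda>x. \<phi> x * \<psi> x)" by (rule test_fun_mult[OF assms(2) \<psi>])
  have g: "grad (\<lambda>x. \<phi> x * \<psi> x) x $ i = \<phi> x * grad \<psi> x $ i + grad \<phi> x $ i * \<psi> x" for x
    by (subst grad_mult) (auto intro: test_fun_differentiable[OF assms(2)] test_fun_differentiable[OF \<psi>])
  obtain K where K: "compact K" "K \<subseteq> \<Omega>" "\<And>x. x \<notin> K \<Longrightarrow> \<phi> x * \<psi> x = 0"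
      "\<And>x. x \<notin> K \<Longrightarrow> grad (\<lambda>x. \<phi> x * \<psi> x) x = 0"
    using test_funD[OF t] by metis
  have "0 = (LINT x|lebesgue. grad (\<lambda>x. \<phi> x * \<psi> x) x $ i)"
    using test_fun_continuous_grad[OF t, of UNIV]
    by (intro integral_grad_eq_0[symmetric, OF test_fun_differentiable[OF t] _ K(1,3)] continuous_intros)
  also have "\<dots> = (LINT x|lebesgue_on \<Omega>. grad (\<lambda>x. \<phi> x * \<psi> x) x $ i)"
    using subsetD[OF K(2)] K(4) assms(1) by (subst lebesgue_integral_on_eq) (force, metis zero_index, simp)
  also have "\<dots> = (LINT x|lebesgue_on \<Omega>. \<phi> x * grad \<psi> x $ i) + (LINT x|lebesgue_on \<Omega>. grad \<phi> x $ i * \<psi> x)"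
    unfolding g using locally_integrable_test_fun[OF assms(1) L(1) \<psi>]
      locally_integrable_test_fun[OF assms(1) locally_integrable_nth[OF L(2)] \<psi>]
    by (intro Bochner_Integration.integral_add) auto
  finally show "(LINT x|lebesgue_on \<Omega>. \<phi> x * grad \<psi> x $ i) = - (LINT x|lebesgue_on \<Omega>. grad \<phi> x $ i * \<psi> x)"
    by simp
qed

lemma locally_integrable_add:
  "locally_integrable \<Omega> f \<Longrightarrow> locally_integrable \<Omega> g \<Longrightarrow> locally_integrable \<Omega> (\<lambda>x. f x + g x)"
  by (auto simp: locally_integrable_def)

text \<open>The weak gradient of \<open>u\<close> is tested with \<phi>\<psi> in place of \<psi>;
  the product rule moves the term containing the gradient of \<phi> to the other side.\<close>

lemma is_weak_grad_mult:
  assumes "open \<Omega>" "is_weak_grad \<Omega> u G" "test_fun \<Omega> \<phi>"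
  shows "is_weak_grad \<Omega> (\<lambda>x. u x * \<phi> x) (\<lambda>x. \<phi> x *\<^sub>R G x + u x *\<^sub>R grad \<phi> x)"
  unfolding is_weak_grad_def
proof (intro conjI allI impI)
  have L: "locally_integrable \<Omega> u" "locally_integrable \<Omega> G" using assms by (auto simp: is_weak_grad_def)
  show "locally_integrable \<Omega> (\<lambda>x. u x * \<phi> x)"
    using locally_integrable_scaleR[OF test_fun_continuous[OF assms(3)] L(1)] by (simp add: mult.commute)
  have "locally_integrable \<Omega> (\<lambda>x. u x *\<^sub>R grad \<phi> x)"
    unfolding locally_integrable_def
  proof (intro allI impI)
    fix K assume K: "compact K \<and> K \<subseteq> \<Omega>"
    then have I: "integrable (lebesgue_on K) u" using L by (simp add: locally_integrable_def)
    have c: "continuous_on UNIV (grad \<phi>)" by (rule test_fun_continuous_grad[OF assms(3)])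
    have "bounded (grad \<phi> ` K)"
      using K by (intro compact_imp_bounded compact_continuous_image test_fun_continuous_grad[OF assms(3)]) auto
    then obtain C where C: "\<And>x. x \<in> K \<Longrightarrow> norm (grad \<phi> x) \<le> C" by (force simp: bounded_iff)
    have "grad \<phi> \<in> borel_measurable (lebesgue_on K)"
      by (rule measurable_restrict_space1[OF continuous_lebesgue_measurable[OF c]])
    with I show "integrable (lebesgue_on K) (\<lambda>x. u x *\<^sub>R grad \<phi> x)"
      by (intro integrable_dominated[OF I, of _ C] AE_I2)
        (auto simp: space_restrict_space mult.commute[of C] intro!: mult_left_mono C)
  qed
  then show "locally_integrable \<Omega> (\<lambda>x. \<phi> x *\<^sub>R G x + u x *\<^sub>R grad \<phi> x)"
    by (intro locally_integrable_add locally_integrable_scaleR[OF test_fun_continuous[OF assms(3)] L(2)])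
  fix \<psi> i assume \<psi>: "test_fun \<Omega> \<psi>"
  have t: "test_fun \<Omega> (\<lambda>x. \<phi> x * \<psi> x)" by (rule test_fun_mult[OF assms(3) \<psi>])
  have I1: "integrable (lebesgue_on \<Omega>) (\<lambda>x. u x * grad (\<lambda>x. \<phi> x * \<psi> x) x $ i)"
    by (rule locally_integrable_test_fun(2)[OF assms(1) L(1) t])
  have Lu: "locally_integrable \<Omega> (\<lambda>x. u x * grad \<phi> x $ i)"
    using locally_integrable_scaleR[of "\<lambda>x. grad \<phi> x $ i", OF _ L(1)] test_fun_continuous_grad[OF assms(3), of UNIV]
    by (auto simp: mult.commute intro!: continuous_intros)
  have I2: "integrable (lebesgue_on \<Omega>) (\<lambda>x. (u x * grad \<phi> x $ i) * \<psi> x)"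
    by (rule locally_integrable_test_fun(1)[OF assms(1) Lu \<psi>])
  have I3: "integrable (lebesgue_on \<Omega>) (\<lambda>x. G x $ i * (\<phi> x * \<psi> x))"
    by (rule locally_integrable_test_fun(1)[OF assms(1) locally_integrable_nth[OF L(2)] t])
  have "grad (\<lambda>x. \<phi> x * \<psi> x) x = \<phi> x *\<^sub>R grad \<psi> x + \<psi> x *\<^sub>R grad \<phi> x" for x
    by (intro grad_mult test_fun_differentiable[OF assms(3)] test_fun_differentiable[OF \<psi>])
  then have "(LINT x|lebesgue_on \<Omega>. u x * \<phi> x * grad \<psi> x $ i) =
      (LINT x|lebesgue_on \<Omega>. u x * grad (\<lambda>x. \<phi> x * \<psi> x) x $ i - (u x * grad \<phi> x $ i) * \<psi> x)"
    by (simp add: algebra_simps)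
  also have "\<dots> = - (LINT x|lebesgue_on \<Omega>. G x $ i * (\<phi> x * \<psi> x)) - (LINT x|lebesgue_on \<Omega>. (u x * grad \<phi> x $ i) * \<psi> x)"
    using I1 I2 assms(2) t by (simp add: is_weak_grad_def)
  also have "\<dots> = - (LINT x|lebesgue_on \<Omega>. G x $ i * (\<phi> x * \<psi> x) + (u x * grad \<phi> x $ i) * \<psi> x)"
    using I2 I3 by simp
  finally show "(LINT x|lebesgue_on \<Omega>. u x * \<phi> x * grad \<psi> x $ i) =
      - (LINT x|lebesgue_on \<Omega>. (\<phi> x *\<^sub>R G x + u x *\<^sub>R grad \<phi> x) $ i * \<psi> x)"
    by (simp add: algebra_simps)
qed

text \<open>A Poincare inequality obtained by integrating the derivative in direction \<open>i\<close> of
  \<open>x\<^sub>i F(\<eta>(x))\<close>, where \<open>F(t) = sqrt (1 + t\<^sup>2) - 1\<close> vanishes only at \<open>0\<close> and \<open>\<bar>F'\<bar> \<le> 1\<close>.\<close>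

lemma poincare_test_fun:
  fixes \<eta> :: "real ^ 'n \<Rightarrow> real"
  assumes "open \<Omega>" "test_fun \<Omega> \<eta>" "\<Omega> \<subseteq> cball 0 R"
  shows "(LINT x|lebesgue_on \<Omega>. sqrt (1 + (\<eta> x)\<^sup>2) - 1) \<le> R * (LINT x|lebesgue_on \<Omega>. \<bar>grad \<eta> x $ i\<bar>)"
proof -
  let ?F = "\<lambda>x. sqrt (1 + (\<eta> x)\<^sup>2) - 1"
  \<comment> \<open>The derivative of the factor \<open>x $ i\<close> is 1 and reproduces F(\<eta>);
    \<open>?h\<close> is the remaining term x_i F'(\<eta>) times the partial derivative of \<eta>. A
    smooth F, unlike the absolute value, leaves the product differentiable where \<eta>
    vanishes.\<close>
  let ?h = "\<lambda>x. x $ i * (\<eta> x / sqrt (1 + (\<eta> x)\<^sup>2)) * grad \<eta> x $ i"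
  obtain K where K: "compact K" "K \<subseteq> \<Omega>" "\<And>x. x \<notin> K \<Longrightarrow> \<eta> x = 0" "\<And>x. x \<notin> K \<Longrightarrow> grad \<eta> x = 0"
    using test_funD[OF assms(2)] by metis
  note c = test_fun_continuous[OF assms(2)] test_fun_continuous_grad[OF assms(2)]
  have pos: "sqrt (1 + (\<eta> x)\<^sup>2) > 0" for x by (simp add: add_pos_nonneg)
  have D: "((\<lambda>x. x $ i * ?F x) has_derivative
      (\<lambda>h. h $ i * ?F x + x $ i * (\<eta> x / sqrt (1 + (\<eta> x)\<^sup>2)) * frechet_derivative \<eta> (at x) h)) (at x)" for x
  proof -
    have d: "(\<eta> has_derivative frechet_derivative \<eta> (at x)) (at x)"
      using test_fun_differentiable[OF assms(2)] by (simp add: frechet_derivative_works)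
    have p: "1 + (\<eta> x)\<^sup>2 > 0" by (simp add: add_pos_nonneg)
    show ?thesis
      using pos[of x] p
      by (auto intro!: derivative_eq_intros d bounded_linear_imp_has_derivative bounded_linear_vec_nth simp: field_simps)
  qed
  have g: "grad (\<lambda>x. x $ i * ?F x) x $ i = ?F x + ?h x" for x
    by (subst grad_nth[OF D]) (simp add: grad_def)
  have cF: "continuous_on UNIV ?F" by (intro continuous_intros c)
  have ch: "continuous_on UNIV ?h"
    using pos by (intro continuous_intros c) (auto simp: less_imp_neq[THEN not_sym])
  have IF: "integrable lebesgue ?F" by (rule integrable_continuous_compact_support[OF cF K(1)]) (simp add: K)
  have Ih: "integrable lebesgue ?h" by (rule integrable_continuous_compact_support[OF ch K(1)]) (simp add: K)
  have Ig: "integrable lebesgue (\<lambda>x. \<bar>grad \<eta> x $ i\<bar>)"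
    by (rule integrable_continuous_compact_support[OF _ K(1)]) (auto simp: K intro!: continuous_intros c)
  have "0 = (LINT x|lebesgue. grad (\<lambda>x. x $ i * ?F x) x $ i)"
  proof (rule integral_grad_eq_0[symmetric, OF _ _ K(1)])
    show "(\<lambda>x. x $ i * ?F x) differentiable at x" for x using D by (auto simp: differentiable_def)
    show "continuous_on UNIV (\<lambda>x. grad (\<lambda>x. x $ i * ?F x) x $ i)"
      unfolding g by (intro continuous_on_add cF ch)
  qed (simp add: K)
  also have "\<dots> = (LINT x|lebesgue. ?F x) + (LINT x|lebesgue. ?h x)"
    unfolding g using IF Ih by (rule Bochner_Integration.integral_add)
  finally have "(LINT x|lebesgue. ?F x) = - (LINT x|lebesgue. ?h x)" by simp
  also have "\<dots> = (LINT x|lebesgue. - ?h x)" by simp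
  also have "\<dots> \<le> (LINT x|lebesgue. R * \<bar>grad \<eta> x $ i\<bar>)"
  proof (rule integral_mono)
    show "integrable lebesgue (\<lambda>x. - ?h x)" using Ih by simp
    show "integrable lebesgue (\<lambda>x. R * \<bar>grad \<eta> x $ i\<bar>)" using Ig by simp
    show "- ?h x \<le> R * \<bar>grad \<eta> x $ i\<bar>" for x
    proof (cases "x \<in> K")
      case True
      then have "\<bar>x $ i\<bar> \<le> R" using K(2) assms(3) component_le_norm_cart[of x i] by (force simp: subset_iff)
      moreover have "\<bar>\<eta> x / sqrt (1 + (\<eta> x)\<^sup>2)\<bar> \<le> 1"
        using pos[of x] by (simp add: real_le_rsqrt)
      ultimately have "\<bar>x $ i * (\<eta> x / sqrt (1 + (\<eta> x)\<^sup>2))\<bar> \<le> R * 1"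
        unfolding abs_mult by (intro mult_mono) auto
      then have "\<bar>?h x\<bar> \<le> R * \<bar>grad \<eta> x $ i\<bar>" unfolding abs_mult[of _ "grad \<eta> x $ i"] by (intro mult_right_mono) auto
      then show ?thesis by linarith
    qed (simp add: K)
  qed
  finally have "(LINT x|lebesgue. ?F x) \<le> R * (LINT x|lebesgue. \<bar>grad \<eta> x $ i\<bar>)" by simp
  moreover have "x \<notin> \<Omega> \<Longrightarrow> \<eta> x = 0 \<and> grad \<eta> x = 0" for x using K by blast
  ultimately show ?thesis
    by (simp add: lebesgue_integral_on_eq[OF assms(1)])
qed

section \<open>Weighted integrability\<close>

text \<open>Completeness of Lebesgue measure is the reason. It serves \<open>wgrad\<close>, a choice
  among weak gradients, whose measurability is inherited from an explicit weak gradient that agrees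
  with it almost everywhere.\<close>

lemma AE_measurable_lebesgue_on:
  fixes f g :: "'a::euclidean_space \<Rightarrow> 'b::euclidean_space"
  assumes "open \<Omega>" "f \<in> borel_measurable (lebesgue_on \<Omega>)" "AE x in lebesgue_on \<Omega>. f x = g x"
  shows "g \<in> borel_measurable (lebesgue_on \<Omega>)"
proof -
  have "(\<lambda>x. if x \<in> \<Omega> then f x else 0) \<in> borel_measurable lebesgue"
    using assms by (simp add: borel_measurable_if)
  moreover have "AE x in lebesgue. (if x \<in> \<Omega> then f x else 0) = (if x \<in> \<Omega> then g x else 0)"
    using assms by (auto simp: AE_restrict_space_iff elim: AE_mp)
  ultimately have "(\<lambda>x. if x \<in> \<Omega> then g x else 0) \<in> borel_measurable lebesgue"
    by (rule borel_measurable_AE)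
  then show ?thesis using assms by (simp add: borel_measurable_if)
qed

text \<open>Near the boundary \<open>a\<close> is bounded below; the remaining compact part of \<open>\<Omega>\<close> is covered by
  finitely many cubes, on which the Muckenhoupt condition applies.\<close>

lemma muckenhoupt_integrable:
  fixes a :: "real ^ 'n \<Rightarrow> real"
  assumes "open \<Omega>" "bounded \<Omega>" and nonneg: "\<forall>x\<in>closure \<Omega>. 0 \<le> a x" and cont: "continuous_on (closure \<Omega>) a"
    and bdry: "\<forall>x\<in>frontier \<Omega>. a x \<noteq> 0" and q: "1 < q" and A: "muckenhoupt \<Omega> q a"
  shows "integrable (lebesgue_on \<Omega>) (\<lambda>x. a x powr (- 1 / (q - 1)))"
proof -
  define w where "w x = a x powr (- 1 / (q - 1))" for x
  have sL: "\<Omega> \<in> sets lebesgue" using assms(1) by simp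
  have "\<exists>U. open U \<and> x \<in> U \<and> set_integrable lebesgue (U \<inter> \<Omega>) w" if x: "x \<in> closure \<Omega>" for x
  proof (cases "x \<in> \<Omega>")
    case True
    then obtain e where e: "e > 0" "ball x e \<subseteq> \<Omega>" using assms(1) openE by metis
    define one :: "real ^ 'n" where "one = (\<chi> i. 1)"
    \<comment> \<open>The cube \<open>Q\<close> is centred at \<open>x\<close> with half diagonal
      \<open>s * norm one\<close>, which this choice keeps below \<open>e\<close>.\<close>
    define s where "s = e / (norm one + 1)"
    have s: "0 < s" using e by (simp add: s_def add_nonneg_pos)
    have so: "s * norm one < e" using e by (simp add: s_def divide_simps add_nonneg_pos)
    define Q where "Q = cbox (x - s *\<^sub>R one) (x - s *\<^sub>R one + (\<chi> i. 2 * s))"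
    have Qe: "Q = cbox (x - s *\<^sub>R one) (x + s *\<^sub>R one)"
      unfolding Q_def by (rule arg_cong2[where f=cbox]) (auto simp: vec_eq_iff one_def)
    have "Q \<subseteq> ball x e"
    proof
      fix y assume "y \<in> Q"
      then have "norm (y - x) \<le> norm (s *\<^sub>R one)"
        using s by (intro norm_le_componentwise_cart) (auto simp: Qe mem_box_cart one_def abs_le_iff algebra_simps)
      with s so show "y \<in> ball x e" by (simp add: dist_norm norm_minus_commute)
    qed
    with e have "Q \<subseteq> \<Omega>" by blast
    with s have "Q \<in> cubes_in \<Omega>"
      unfolding cubes_in_def Q_def by (auto intro!: exI[of _ "x - s *\<^sub>R one"] exI[of _ "2 * s"])
    with A have "integrable (lebesgue_on Q) w" by (simp add: muckenhoupt_def w_def[abs_def])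
    then have "set_integrable lebesgue Q w" by (simp add: set_integrable_lebesgue_on Qe)
    moreover have "box (x - s *\<^sub>R one) (x + s *\<^sub>R one) \<subseteq> Q" unfolding Qe by (rule box_subset_cbox)
    ultimately have "set_integrable lebesgue (box (x - s *\<^sub>R one) (x + s *\<^sub>R one) \<inter> \<Omega>) w"
      using sL by (elim set_integrable_subset) auto
    moreover have "x \<in> box (x - s *\<^sub>R one) (x + s *\<^sub>R one)" using s by (auto simp: mem_box_cart one_def)
    ultimately show ?thesis using open_box by blast
  next
    case False
    then have "x \<in> frontier \<Omega>" using x interior_subset by (auto simp: frontier_def)
    with bdry nonneg x have ax: "a x > 0" by force
    then obtain d where d: "d > 0" "\<And>y. y \<in> closure \<Omega> \<Longrightarrow> dist y x < d \<Longrightarrow> dist (a y) (a x) < a x / 2"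
      using cont x unfolding continuous_on_iff by (metis half_gt_zero)
    \<comment> \<open>The exponent -1/(q-1) is negative, so the lower bound a(x)/2 on the weight
      becomes an upper bound on \<open>w\<close>.\<close>
    have w: "w y \<le> (a x / 2) powr (- 1 / (q - 1))" if "y \<in> ball x d \<inter> \<Omega>" for y
    proof -
      have "dist (a y) (a x) < a x / 2"
        using that closure_subset[of \<Omega>] by (intro d(2)) (auto simp: dist_commute)
      then have "a x / 2 \<le> a y" unfolding dist_real_def by linarith
      then show ?thesis unfolding w_def using ax q by (intro powr_mono2') (auto simp: divide_simps)
    qed
    have L: "ball x d \<inter> \<Omega> \<in> lmeasurable" using assms(1) by (intro lmeasurable_open) auto
    have "continuous_on (ball x d \<inter> \<Omega>) a"
      using cont closure_subset[of \<Omega>] by (rule_tac continuous_on_subset[OF cont]) auto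
    then have "a \<in> borel_measurable (lebesgue_on (ball x d \<inter> \<Omega>))"
      using L by (intro continuous_imp_measurable_on_sets_lebesgue) auto
    then have "w \<in> borel_measurable (lebesgue_on (ball x d \<inter> \<Omega>))" unfolding w_def[abs_def] by measurable
    moreover have "integrable (lebesgue_on (ball x d \<inter> \<Omega>)) (\<lambda>y. 1 :: real)"
      using finite_measure_lebesgue_on[OF L] by (simp add: finite_measure.integrable_const)
    ultimately have "integrable (lebesgue_on (ball x d \<inter> \<Omega>)) w"
      using w by (intro integrable_dominated[of _ "\<lambda>y. 1 :: real" w "(a x / 2) powr (- 1 / (q - 1))"] AE_I2)
        (auto simp: space_restrict_space w_def)
    then have "set_integrable lebesgue (ball x d \<inter> \<Omega>) w" using L by (simp add: set_integrable_lebesgue_on fmeasurableD)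
    then show ?thesis using d(1) by (meson centre_in_ball open_ball)
  qed
  then obtain U where U: "\<And>x. x \<in> closure \<Omega> \<Longrightarrow> open (U x) \<and> x \<in> U x \<and> set_integrable lebesgue (U x \<inter> \<Omega>) w"
    by metis
  have "compact (closure \<Omega>)" using assms(2) by simp
  then obtain T where T: "T \<subseteq> closure \<Omega>" "finite T" "closure \<Omega> \<subseteq> (\<Union>x\<in>T. U x)"
    by (rule compactE_image[of _ "closure \<Omega>" U]) (use U in auto)
  have "set_integrable lebesgue (\<Union>x\<in>T. U x \<inter> \<Omega>) w"
  proof (intro set_integrable_UN T(2))
    fix x assume "x \<in> T"
    with T(1) U have "open (U x)" "set_integrable lebesgue (U x \<inter> \<Omega>) w" by auto
    then show "set_integrable lebesgue (U x \<inter> \<Omega>) w" "U x \<inter> \<Omega> \<in> sets lebesgue"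
      using assms(1) by auto
  qed
  then have "set_integrable lebesgue \<Omega> w"
    using sL T(3) closure_subset[of \<Omega>] by (elim set_integrable_subset) auto
  then show ?thesis by (simp add: set_integrable_lebesgue_on sL w_def[abs_def])
qed

text \<open>At \<open>y = 0\<close> both sides vanish because \<open>0 powr r = 0\<close> for every
  \<open>r\<close>. This covers the flux factor with exponent \<open>q - 2\<close>, which is
  negative for \<open>q < 2\<close>.\<close>

lemma powr_times_self: "0 \<le> (y::real) \<Longrightarrow> y powr (q - 1) * y = y powr q"
  by (cases "y = 0") (auto simp: powr_diff)

text \<open>Young's inequality with a parameter. If x <= \<delta> y, replacing \<open>x\<close>
  gives the first summand; otherwise y <= x/\<delta>, and replacing \<open>y\<close> gives the
  second, whose constant comes from (x/\<delta>)^(q-1).\<close>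

lemma powr_mult_le:
  fixes x y :: real
  assumes "1 < q" "0 \<le> x" "0 \<le> y" "0 < \<delta>"
  shows "y powr (q - 1) * x \<le> \<delta> * y powr q + \<delta> powr (1 - q) * x powr q"
proof (cases "x \<le> \<delta> * y")
  case True
  have "y powr (q - 1) * x \<le> y powr (q - 1) * (\<delta> * y)" using True by (intro mult_left_mono) auto
  also have "\<dots> = \<delta> * y powr q" using powr_times_self[OF assms(3), of q] by (simp add: algebra_simps)
  finally show ?thesis using assms by (simp add: add_increasing2)
next
  case False
  then have "y \<le> x / \<delta>" using assms by (simp add: field_simps)
  then have "y powr (q - 1) * x \<le> (x / \<delta>) powr (q - 1) * x"
    using assms by (intro mult_right_mono powr_mono2) auto
  also have "\<dots> = \<delta> powr (1 - q) * (x powr (q - 1) * x)"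
    using assms by (simp add: powr_divide powr_diff)
  also have "\<dots> = \<delta> powr (1 - q) * x powr q" using powr_times_self[OF assms(2)] by simp
  finally show ?thesis using assms by (simp add: add_increasing)
qed

section \<open>The weighted space and its embedding in L^1\<close>

locale weight =
  fixes \<Omega> :: "(real ^ 'n) set" and a :: "real ^ 'n \<Rightarrow> real" and q C :: real
  assumes op: "open \<Omega>" and bd: "bounded \<Omega>" and q: "1 < q"
    and a_nonneg: "\<And>x. x \<in> \<Omega> \<Longrightarrow> 0 \<le> a x" and a_le: "\<And>x. x \<in> \<Omega> \<Longrightarrow> a x \<le> C"
    and a_meas: "a \<in> borel_measurable (lebesgue_on \<Omega>)"
    and a_pos: "AE x in lebesgue_on \<Omega>. 0 < a x"
    and a_int: "integrable (lebesgue_on \<Omega>) (\<lambda>x. a x powr (- 1 / (q - 1)))"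
begin

abbreviation "M \<equiv> lebesgue_on \<Omega>"

lemma space_M [simp]: "space M = \<Omega>" by (simp add: space_restrict_space)

lemma finite_M: "finite_measure M"
  using bd op lmeasurable_open[of \<Omega>] by (intro finite_measure_lebesgue_on) auto

lemma C_nonneg: "\<Omega> \<noteq> {} \<Longrightarrow> 0 \<le> C"
  using a_nonneg a_le by (metis all_not_in_conv order_trans)

lemma in_L_diff:
  fixes f g :: "real ^ 'n \<Rightarrow> 'b::euclidean_space"
  assumes "in_L \<Omega> a q f" "in_L \<Omega> a q g" shows "in_L \<Omega> a q (\<lambda>x. f x - g x)"
proof -
  have [measurable]: "f \<in> borel_measurable M" "g \<in> borel_measurable M" "a \<in> borel_measurable M"
    using assms a_meas by (auto simp: in_L_def)
  have I: "integrable M (\<lambda>x. a x * norm (f x) powr q + a x * norm (g x) powr q)"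
    using assms by (auto simp: in_L_def)
  have "integrable M (\<lambda>x. a x * norm (f x - g x) powr q)"
  proof (rule integrable_dominated[OF I, of _ "2 powr q"])
    show "AE x in M. norm (a x * norm (f x - g x) powr q) \<le> 2 powr q * norm (a x * norm (f x) powr q + a x * norm (g x) powr q)"
    proof (rule AE_I2)
      fix x assume x: "x \<in> space M"
      \<comment> \<open>The constant \<open>2 powr q\<close> comes from |f - g| <= 2 max(|f|,|g|),
        and the q-th power of the maximum is at most the sum of the q-th powers.\<close>
      let ?m = "max (norm (f x)) (norm (g x))"
      have "norm (f x - g x) \<le> 2 * ?m" using norm_triangle_ineq4[of "f x" "g x"] by linarith
      then have "norm (f x - g x) powr q \<le> (2 * ?m) powr q" using q by (intro powr_mono2) auto
      also have "\<dots> = 2 powr q * ?m powr q" by (simp add: powr_mult)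
      also have "?m powr q \<le> norm (f x) powr q + norm (g x) powr q" by (simp add: max_def)
      finally have "norm (f x - g x) powr q \<le> 2 powr q * (norm (f x) powr q + norm (g x) powr q)" by simp
      then have "a x * norm (f x - g x) powr q \<le> a x * (2 powr q * (norm (f x) powr q + norm (g x) powr q))"
        using a_nonneg x by (intro mult_left_mono) auto
      then show "norm (a x * norm (f x - g x) powr q) \<le> 2 powr q * norm (a x * norm (f x) powr q + a x * norm (g x) powr q)"
        using a_nonneg x by (simp add: abs_mult algebra_simps)
    qed
  qed measurable
  then show ?thesis by (simp add: in_L_def)
qed

lemma in_L_bounded:
  fixes g :: "real ^ 'n \<Rightarrow> 'b::euclidean_space"
  assumes "g \<in> borel_measurable M" "\<And>x. norm (g x) \<le> B" shows "in_L \<Omega> a q g"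
proof -
  interpret finite_measure M by (rule finite_M)
  have [measurable]: "g \<in> borel_measurable M" "a \<in> borel_measurable M"
    using assms a_meas by (auto simp: in_L_def)
  have "integrable M (\<lambda>x. a x * norm (g x) powr q)"
  proof (rule integrable_const_bound)
    show "AE x in M. norm (a x * norm (g x) powr q) \<le> C * B powr q"
      using a_nonneg a_le assms(2) q C_nonneg by (intro AE_I2) (auto simp: abs_mult intro!: mult_mono powr_mono2)
  qed measurable
  with assms show ?thesis by (simp add: in_L_def)
qed

lemma weighted_le:
  assumes "x \<in> \<Omega>" "0 < \<delta>"
  shows "a x * norm y powr (q - 1) * norm z \<le> \<delta> * (a x * norm y powr q) + \<delta> powr (1 - q) * (a x * norm z powr q)"
  using mult_left_mono[OF powr_mult_le[OF q norm_ge_zero[of z] norm_ge_zero[of y] assms(2)] a_nonneg[OF assms(1)]]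
  by (simp add: algebra_simps)

text \<open>Young's inequality with parameter 1 provides the majorant. The product of
  \<open>a\<close> with a power \<open>q - 1\<close> is the shape in which both vector fields of the
  equation are later bounded.\<close>

lemma integrable_pairing:
  fixes f :: "real ^ 'n \<Rightarrow> 'b::euclidean_space" and g :: "real ^ 'n \<Rightarrow> 'c::euclidean_space"
  assumes "in_L \<Omega> a q f" "in_L \<Omega> a q g"
  shows "integrable M (\<lambda>x. a x * norm (f x) powr (q - 1) * norm (g x))"
proof -
  have [measurable]: "f \<in> borel_measurable M" "g \<in> borel_measurable M" "a \<in> borel_measurable M"
    using assms a_meas by (auto simp: in_L_def)
  have I: "integrable M (\<lambda>x. a x * norm (f x) powr q + a x * norm (g x) powr q)"
    using assms by (auto simp: in_L_def)
  then show ?thesis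
  proof (rule integrable_dominated[of _ _ _ 1])
    show "AE x in M. norm (a x * norm (f x) powr (q - 1) * norm (g x)) \<le> 1 * norm (a x * norm (f x) powr q + a x * norm (g x) powr q)"
    proof (rule AE_I2)
      fix x assume "x \<in> space M"
      then show "norm (a x * norm (f x) powr (q - 1) * norm (g x)) \<le> 1 * norm (a x * norm (f x) powr q + a x * norm (g x) powr q)"
        using weighted_le[of x 1 "f x" "g x"] a_nonneg[of x] by (simp add: abs_mult)
    qed
  qed measurable
qed

lemma norm_L_tendsto:
  assumes "(\<lambda>k. norm_L \<Omega> a q (g k)) \<longlonglongrightarrow> 0"
  shows "(\<lambda>k. LINT x|M. a x * norm (g k x) powr q) \<longlonglongrightarrow> 0"
proof -
  have nn: "0 \<le> (LINT x|M. a x * norm (g k x) powr q)" for k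
    using a_nonneg by (intro integral_nonneg_AE AE_I2) auto
  have "(\<lambda>k. norm_L \<Omega> a q (g k) powr q) \<longlonglongrightarrow> 0"
    by (rule tendsto_eq_rhs, rule tendsto_powr'[OF assms tendsto_const]) (use q in \<open>auto simp: norm_L_def\<close>)
  then show ?thesis using q nn by (simp add: norm_L_def powr_powr)
qed

text \<open>In \<delta> F + \<delta>^(1-q) G_k the first term is small by the choice of \<delta>,
  and for that fixed \<delta> the second tends to 0. This takes the place of Hoelder's
  inequality.\<close>

lemma pairing_tendsto:
  fixes f :: "real ^ 'n \<Rightarrow> 'b::euclidean_space" and g :: "nat \<Rightarrow> real ^ 'n \<Rightarrow> 'c::euclidean_space"
  assumes f: "in_L \<Omega> a q f" and g: "\<And>k. in_L \<Omega> a q (g k)" and lim: "(\<lambda>k. norm_L \<Omega> a q (g k)) \<longlonglongrightarrow> 0"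
  shows "(\<lambda>k. LINT x|M. a x * norm (f x) powr (q - 1) * norm (g k x)) \<longlonglongrightarrow> 0"
proof -
  define F where "F = (LINT x|M. a x * norm (f x) powr q)"
  define G where "G k = (LINT x|M. a x * norm (g k x) powr q)" for k
  define P where "P k = (LINT x|M. a x * norm (f x) powr (q - 1) * norm (g k x))" for k
  have F: "0 \<le> F" unfolding F_def using a_nonneg by (intro integral_nonneg_AE AE_I2) auto
  have P: "0 \<le> P k" for k unfolding P_def using a_nonneg by (intro integral_nonneg_AE AE_I2) auto
  have le: "P k \<le> \<delta> * F + \<delta> powr (1 - q) * G k" if "\<delta> > 0" for \<delta> k
  proof -
    have I: "integrable M (\<lambda>x. a x * norm (f x) powr q)" "integrable M (\<lambda>x. a x * norm (g k x) powr q)"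
      using f g[of k] by (auto simp: in_L_def)
    have "P k \<le> (LINT x|M. \<delta> * (a x * norm (f x) powr q) + \<delta> powr (1 - q) * (a x * norm (g k x) powr q))"
      unfolding P_def using I
      by (intro integral_mono integrable_pairing f g weighted_le that) auto
    also have "\<dots> = \<delta> * F + \<delta> powr (1 - q) * G k"
      unfolding F_def G_def using I by simp
    finally show ?thesis .
  qed
  have G: "G \<longlonglongrightarrow> 0" unfolding G_def[abs_def] by (rule norm_L_tendsto[OF lim])
  have "P \<longlonglongrightarrow> 0"
  proof (rule LIMSEQ_I)
    fix e :: real assume e: "0 < e"
    \<comment> \<open>Half of \<open>e\<close> is spent on \<delta> F; the added 1 covers
      \<open>F = 0\<close>.\<close>
    define \<delta> where "\<delta> = e / (2 * (F + 1))"
    have \<delta>: "\<delta> > 0" using e F by (simp add: \<delta>_def)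
    have \<delta>F: "\<delta> * F < e / 2" using e F by (simp add: \<delta>_def divide_simps mult_less_0_iff)
    have "(\<lambda>k. \<delta> powr (1 - q) * G k) \<longlonglongrightarrow> 0" using tendsto_mult_left[OF G, of "\<delta> powr (1 - q)"] by simp
    then obtain N where "\<And>k. k \<ge> N \<Longrightarrow> \<bar>\<delta> powr (1 - q) * G k\<bar> < e / 2"
      using LIMSEQ_D[of _ 0 "e / 2"] e by fastforce
    then have "\<bar>P k\<bar> < e" if "k \<ge> N" for k using that le[OF \<delta>, of k] \<delta>F P[of k] by fastforce
    then show "\<exists>N. \<forall>k\<ge>N. norm (P k - 0) < e" by auto
  qed
  then show ?thesis by (simp add: P_def[abs_def])
qed

text \<open>The exponents satisfy 1 - q/(q-1) = -1/(q-1), so \<open>a\<close> times the q-th power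
  of the dual weight is the dual weight again, which is integrable by \<open>a_int\<close>.\<close>

lemma in_L_dual_weight: "in_L \<Omega> a q (\<lambda>x. a x powr (- 1 / (q - 1)))"
proof -
  have [measurable]: "a \<in> borel_measurable M" using a_meas .
  have "integrable M (\<lambda>x. a x * norm (a x powr (- 1 / (q - 1))) powr q)"
  proof (rule integrable_dominated[OF a_int, of _ 1])
    show "AE x in M. norm (a x * norm (a x powr (- 1 / (q - 1))) powr q) \<le> 1 * norm (a x powr (- 1 / (q - 1)))"
      using a_pos
    proof eventually_elim
      fix x assume x: "0 < a x"
      have "1 + (- 1 / (q - 1)) * q = - 1 / (q - 1)" using q by (simp add: field_simps)
      then have "a x * a x powr ((- 1 / (q - 1)) * q) = a x powr (- 1 / (q - 1))"
        using x powr_add[of "a x" 1 "(- 1 / (q - 1)) * q"] by simp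
      then have "a x * norm (a x powr (- 1 / (q - 1))) powr q = a x powr (- 1 / (q - 1))"
        by (simp only: real_norm_def abs_of_nonneg[OF powr_ge_zero] powr_powr)
      then show "norm (a x * norm (a x powr (- 1 / (q - 1))) powr q) \<le> 1 * norm (a x powr (- 1 / (q - 1)))"
        by simp
    qed
  qed measurable
  then show ?thesis by (simp add: in_L_def)
qed

text \<open>The (q-1)-th power of the dual weight is 1/a wherever \<open>a\<close> is positive. An
  unweighted integral is thus a weighted pairing with a fixed function, which reduces integrability
  and L^1 convergence to the lemmas on pairings.\<close>

lemma dual_weight_pairing:
  "AE x in M. a x * norm (a x powr (- 1 / (q - 1))) powr (q - 1) * t x = t x"
  using a_pos
proof eventually_elim
  fix x assume "0 < a x"
  then show "a x * norm (a x powr (- 1 / (q - 1))) powr (q - 1) * t x = t x"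
  proof -
    have "norm (a x powr (- 1 / (q - 1))) powr (q - 1) = a x powr ((- 1 / (q - 1)) * (q - 1))"
      by (simp only: real_norm_def abs_of_nonneg[OF powr_ge_zero] powr_powr)
    also have "(- 1 / (q - 1)) * (q - 1) = - 1" using q by simp
    finally show ?thesis using \<open>0 < a x\<close> by (simp add: powr_minus)
  qed
qed

lemma in_L_integrable:
  fixes g :: "real ^ 'n \<Rightarrow> 'b::euclidean_space"
  assumes "in_L \<Omega> a q g"
  shows "integrable M g"
proof (rule integrable_dominated[OF integrable_pairing[OF in_L_dual_weight assms], of _ 1])
  show "g \<in> borel_measurable M" using assms by (simp add: in_L_def)
  show "AE x in M. norm (g x) \<le> 1 * norm (a x * norm (a x powr (- 1 / (q - 1))) powr (q - 1) * norm (g x))"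
    using dual_weight_pairing[of "\<lambda>x. norm (g x)"] by eventually_elim auto
qed

lemma L1_tendsto:
  fixes g :: "nat \<Rightarrow> real ^ 'n \<Rightarrow> 'c::euclidean_space"
  assumes g: "\<And>k. in_L \<Omega> a q (g k)" and lim: "(\<lambda>k. norm_L \<Omega> a q (g k)) \<longlonglongrightarrow> 0"
  shows "(\<lambda>k. LINT x|M. norm (g k x)) \<longlonglongrightarrow> 0"
proof -
  have "(LINT x|M. a x * norm (a x powr (- 1 / (q - 1))) powr (q - 1) * norm (g k x)) = (LINT x|M. norm (g k x))" for k
  proof (rule integral_cong_AE)
    show "(\<lambda>x. norm (g k x)) \<in> borel_measurable M" using g[of k] by (auto simp: in_L_def)
    show "(\<lambda>x. a x * norm (a x powr (- 1 / (q - 1))) powr (q - 1) * norm (g k x)) \<in> borel_measurable M"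
      using integrable_pairing[OF in_L_dual_weight g[of k]] by (rule borel_measurable_integrable)
  qed (rule dual_weight_pairing)
  with pairing_tendsto[OF in_L_dual_weight g lim] show ?thesis by simp
qed

section \<open>Approximation by test functions\<close>

lemma test_fun_bounded:
  assumes "test_fun \<Omega> \<phi>"
  obtains B where "0 < B" "\<And>x. \<bar>\<phi> x\<bar> \<le> B" "\<And>x. norm (grad \<phi> x) \<le> B"
proof -
  obtain K where K: "compact K" "\<And>x. x \<notin> K \<Longrightarrow> \<phi> x = 0" "\<And>x. x \<notin> K \<Longrightarrow> grad \<phi> x = 0"
    using test_funD[OF assms] by metis
  have "bounded (\<phi> ` K)" "bounded (grad \<phi> ` K)"
    using K test_fun_continuous[OF assms] test_fun_continuous_grad[OF assms]
    by (auto intro!: compact_imp_bounded compact_continuous_image)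
  then obtain B B' where B: "B > 0" "\<And>x. x \<in> K \<Longrightarrow> \<bar>\<phi> x\<bar> \<le> B" "B' > 0" "\<And>x. x \<in> K \<Longrightarrow> norm (grad \<phi> x) \<le> B'"
    by (auto simp: bounded_pos)
  show ?thesis
  proof (rule that[of "max B B'"])
    show "\<bar>\<phi> x\<bar> \<le> max B B'" for x using B(1) B(2)[of x] K(2)[of x] by (cases "x \<in> K") auto
    show "norm (grad \<phi> x) \<le> max B B'" for x using B(3) B(4)[of x] K(3)[of x] by (cases "x \<in> K") auto
  qed (use B in auto)
qed

lemma test_fun_measurable:
  assumes "test_fun \<Omega> \<phi>"
  shows "\<phi> \<in> borel_measurable M" "grad \<phi> \<in> borel_measurable M"
  using assms op
  by (auto intro!: continuous_imp_measurable_on_sets_lebesgue test_fun_continuous test_fun_continuous_grad)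

lemma test_fun_in_L:
  assumes "test_fun \<Omega> \<phi>"
  shows "in_L \<Omega> a q \<phi>" "in_L \<Omega> a q (grad \<phi>)"
proof -
  obtain B where "\<And>x. \<bar>\<phi> x\<bar> \<le> B" "\<And>x. norm (grad \<phi> x) \<le> B"
    using test_fun_bounded[OF assms] by metis
  then show "in_L \<Omega> a q \<phi>" "in_L \<Omega> a q (grad \<phi>)"
    using test_fun_measurable[OF assms] by (auto intro!: in_L_bounded)
qed

text \<open>The norm in \<open>in_W0\<close> refers to the chosen gradient of
  \<open>u - \<phi>\<close>. Uniqueness of weak gradients identifies it almost everywhere with
  \<open>wgrad \<Omega> u - grad \<phi>\<close>, the form in which limits can be taken.\<close>

lemma in_W0_approx:
  assumes "in_W0 \<Omega> a q u"
  obtains \<phi> where "\<And>k. test_fun \<Omega> (\<phi> k)"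
    "\<And>k. in_L \<Omega> a q (\<lambda>x. u x - \<phi> k x)" "\<And>k. in_L \<Omega> a q (\<lambda>x. wgrad \<Omega> u x - grad (\<phi> k) x)"
    "(\<lambda>k. norm_L \<Omega> a q (\<lambda>x. u x - \<phi> k x)) \<longlonglongrightarrow> 0"
    "(\<lambda>k. norm_L \<Omega> a q (\<lambda>x. wgrad \<Omega> u x - grad (\<phi> k) x)) \<longlonglongrightarrow> 0"
proof -
  have u: "in_L \<Omega> a q u" "in_L \<Omega> a q (wgrad \<Omega> u)" "is_weak_grad \<Omega> u (wgrad \<Omega> u)"
    using assms is_weak_grad_wgrad by (auto simp: in_W0_def in_W_def)
  have "\<forall>k. \<exists>\<phi>. test_fun \<Omega> \<phi> \<and> norm_W \<Omega> a q (\<lambda>x. u x - \<phi> x) < inverse (real (Suc k))"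
    using assms by (simp add: in_W0_def)
  then obtain \<phi> where \<phi>: "\<And>k. test_fun \<Omega> (\<phi> k)" "\<And>k. norm_W \<Omega> a q (\<lambda>x. u x - \<phi> k x) < inverse (real (Suc k))"
    by metis
  note L = test_fun_in_L[OF \<phi>(1)]
  have d: "in_L \<Omega> a q (\<lambda>x. u x - \<phi> k x)" "in_L \<Omega> a q (\<lambda>x. wgrad \<Omega> u x - grad (\<phi> k) x)" for k
    using in_L_diff[OF u(1) L(1)] in_L_diff[OF u(2) L(2)] by auto
  have eq: "norm_L \<Omega> a q (wgrad \<Omega> (\<lambda>x. u x - \<phi> k x)) = norm_L \<Omega> a q (\<lambda>x. wgrad \<Omega> u x - grad (\<phi> k) x)" for k
  proof -
    have "is_weak_grad \<Omega> (\<lambda>x. u x - \<phi> k x) (\<lambda>x. wgrad \<Omega> u x - grad (\<phi> k) x)"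
      by (rule is_weak_grad_diff[OF op u(3) is_weak_grad_test_fun[OF op \<phi>(1)]])
    then have ae: "AE x in M. wgrad \<Omega> u x - grad (\<phi> k) x = wgrad \<Omega> (\<lambda>x. u x - \<phi> k x) x"
      using is_weak_grad_wgrad is_weak_grad_unique[OF op] by blast
    have m: "(\<lambda>x. wgrad \<Omega> u x - grad (\<phi> k) x) \<in> borel_measurable M" using d(2)[of k] by (simp add: in_L_def)
    note [measurable] = m AE_measurable_lebesgue_on[OF op m ae] a_meas
    have "(LINT x|M. a x * norm (wgrad \<Omega> u x - grad (\<phi> k) x) powr q) = (LINT x|M. a x * norm (wgrad \<Omega> (\<lambda>x. u x - \<phi> k x) x) powr q)"
    proof (rule integral_cong_AE)
      show "AE x in M. a x * norm (wgrad \<Omega> u x - grad (\<phi> k) x) powr q = a x * norm (wgrad \<Omega> (\<lambda>x. u x - \<phi> k x) x) powr q"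
        using ae by eventually_elim simp
    qed measurable
    then show ?thesis by (simp add: norm_L_def)
  qed
  have le: "norm_L \<Omega> a q (\<lambda>x. u x - \<phi> k x) + norm_L \<Omega> a q (\<lambda>x. wgrad \<Omega> u x - grad (\<phi> k) x) < inverse (real (Suc k))" for k
    using \<phi>(2)[of k] eq[of k] by (simp add: norm_W_def)
  have nn: "0 \<le> norm_L \<Omega> a q h" for h :: "real ^ 'n \<Rightarrow> 'b::euclidean_space" by (simp add: norm_L_def)
  show ?thesis
  proof (rule that[OF \<phi>(1) d])
    show "(\<lambda>k. norm_L \<Omega> a q (\<lambda>x. u x - \<phi> k x)) \<longlonglongrightarrow> 0"
    proof (rule tendsto_sandwich[OF _ _ tendsto_const LIMSEQ_inverse_real_of_nat])
      show "\<forall>\<^sub>F k in sequentially. norm_L \<Omega> a q (\<lambda>x. u x - \<phi> k x) \<le> inverse (real (Suc k))"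
      proof (rule always_eventually, rule allI)
        show "norm_L \<Omega> a q (\<lambda>x. u x - \<phi> k x) \<le> inverse (real (Suc k))" for k
          using le[of k] nn[of "\<lambda>x. wgrad \<Omega> u x - grad (\<phi> k) x"] by linarith
      qed
    qed (simp add: nn)
    show "(\<lambda>k. norm_L \<Omega> a q (\<lambda>x. wgrad \<Omega> u x - grad (\<phi> k) x)) \<longlonglongrightarrow> 0"
    proof (rule tendsto_sandwich[OF _ _ tendsto_const LIMSEQ_inverse_real_of_nat])
      show "\<forall>\<^sub>F k in sequentially. norm_L \<Omega> a q (\<lambda>x. wgrad \<Omega> u x - grad (\<phi> k) x) \<le> inverse (real (Suc k))"
      proof (rule always_eventually, rule allI)
        show "norm_L \<Omega> a q (\<lambda>x. wgrad \<Omega> u x - grad (\<phi> k) x) \<le> inverse (real (Suc k))" for k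
          using le[of k] nn[of "\<lambda>x. u x - \<phi> k x"] by linarith
      qed
    qed (simp add: nn)
  qed
qed

end

section \<open>Total variation and monotonicity\<close>

text \<open>For s, t the norms of the two vectors, Cauchy-Schwarz gives m >= (s^(q-1) - t^(q-1)) (s
  - t), which is positive unless s = t since the power is strictly increasing. The case of equal
  norms is then settled by the inner product.\<close>

lemma flux_strict_mono:
  fixes \<xi> \<zeta> :: "'a::real_inner"
  assumes q: "1 < q"
  defines "m \<equiv> (norm \<xi> powr (q - 2) *\<^sub>R \<xi> - norm \<zeta> powr (q - 2) *\<^sub>R \<zeta>) \<bullet> (\<xi> - \<zeta>)"
  shows "0 \<le> m" "m = 0 \<Longrightarrow> \<xi> = \<zeta>"
proof -
  define s t A B where "s = norm \<xi>" and "t = norm \<zeta>" and "A = s powr (q - 2)" and "B = t powr (q - 2)"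
  have nn: "0 \<le> s" "0 \<le> t" "0 \<le> A" "0 \<le> B" by (auto simp: s_def t_def A_def B_def)
  have m: "m = A * s\<^sup>2 + B * t\<^sup>2 - (A + B) * (\<xi> \<bullet> \<zeta>)"
    by (simp add: m_def A_def B_def s_def t_def power2_norm_eq_inner inner_diff_left inner_diff_right inner_commute algebra_simps)
  have cs: "\<xi> \<bullet> \<zeta> \<le> s * t" unfolding s_def t_def by (rule norm_cauchy_schwarz)
  have As: "A * s = s powr (q - 1)" and Bt: "B * t = t powr (q - 1)"
    using powr_times_self[OF nn(1), of "q - 1"] powr_times_self[OF nn(2), of "q - 1"]
    by (auto simp: A_def B_def)
  have "(A + B) * (\<xi> \<bullet> \<zeta>) \<le> (A + B) * (s * t)" using cs nn by (intro mult_left_mono) auto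
  then have "(A * s - B * t) * (s - t) \<le> m"
    unfolding m by (simp add: algebra_simps power2_eq_square)
  then have ge: "(s powr (q - 1) - t powr (q - 1)) * (s - t) \<le> m" unfolding As Bt .
  have pos: "0 < (s powr (q - 1) - t powr (q - 1)) * (s - t)" if "s \<noteq> t"
  proof (cases "s < t")
    case True
    with nn q have "s powr (q - 1) < t powr (q - 1)" by (intro powr_less_mono2) auto
    with True show ?thesis by (intro mult_neg_neg) auto
  next
    case False
    with that nn q have "t < s" "t powr (q - 1) < s powr (q - 1)" by (auto intro!: powr_less_mono2)
    then show ?thesis by (intro mult_pos_pos) auto
  qed
  show "0 \<le> m" using ge pos by (cases "s = t") auto
  assume m0: "m = 0"
  then have st: "s = t" using ge pos by force
  \<comment> \<open>For equal norms the two factors agree and \<open>m\<close> is \<open>A\<close>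
    times the squared distance. If \<open>A\<close> vanishes then so does the common norm, and both
    vectors are 0.\<close>
  have "A * ((\<xi> - \<zeta>) \<bullet> (\<xi> - \<zeta>)) = 0"
    using m0 st unfolding m B_def[folded st] A_def[symmetric]
    by (simp add: inner_diff_left inner_diff_right power2_norm_eq_inner s_def t_def inner_commute algebra_simps)
  then show "\<xi> = \<zeta>"
    using st by (auto simp: A_def s_def t_def)
qed

text \<open>Approximation by simple functions carries the inequality from sets to nonnegative
  functions. Because the left side is a signed combination, limits are taken measure by measure with
  dominated convergence, for which boundedness and finite measures provide the majorant.\<close>

lemma integral_le_if_measure_le:
  fixes P N :: "'i::finite \<Rightarrow> 'a measure" and c :: real and e :: "'i \<Rightarrow> real" and \<phi> :: "'a \<Rightarrow> real"
  assumes fin: "finite_measure \<mu>" "\<And>i. finite_measure (P i)" "\<And>i. finite_measure (N i)"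
    and sets: "\<And>i. sets (P i) = sets \<mu>" "\<And>i. sets (N i) = sets \<mu>"
    and le: "\<And>B. B \<in> sets \<mu> \<Longrightarrow> (\<Sum>i\<in>UNIV. e i * (measure (P i) B - measure (N i) B)) \<le> c * measure \<mu> B"
    and \<phi>: "\<phi> \<in> borel_measurable \<mu>" "\<And>x. 0 \<le> \<phi> x" "\<And>x. \<phi> x \<le> K"
  shows "(\<Sum>i\<in>UNIV. e i * ((LINT x|P i. \<phi> x) - (LINT x|N i. \<phi> x))) \<le> c * (LINT x|\<mu>. \<phi> x)"
proof -
  have sp: "space (P i) = space \<mu>" "space (N i) = space \<mu>" for i
    using sets_eq_imp_space_eq[OF sets(1)] sets_eq_imp_space_eq[OF sets(2)] by auto
  have I: "integrable \<nu> f"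
    if "finite_measure \<nu>" "sets \<nu> = sets \<mu>" "f \<in> borel_measurable \<mu>" "\<And>x. 0 \<le> f x" "\<And>x. x \<in> space \<mu> \<Longrightarrow> f x \<le> K"
    for \<nu> and f :: "'a \<Rightarrow> real" and K
  proof -
    interpret finite_measure \<nu> by fact
    have "f \<in> borel_measurable \<nu>" using that measurable_cong_sets[OF that(2) refl] by blast
    then show ?thesis
      using that sets_eq_imp_space_eq[OF that(2)] by (intro integrable_const_bound[of _ K] AE_I2) auto
  qed
  \<comment> \<open>The bound is quantified inside the induction statement because it changes along
    the way: a scalar factor \<open>b\<close> replaces \<open>K\<close> by
    \<open>K / b\<close>.\<close>
  have "\<forall>K. (\<forall>x\<in>space \<mu>. \<phi> x \<le> K) \<longrightarrow>
      (\<Sum>i\<in>UNIV. e i * ((LINT x|P i. \<phi> x) - (LINT x|N i. \<phi> x))) \<le> c * (LINT x|\<mu>. \<phi> x)"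
    using \<phi>(1,2)
  proof (induction rule: borel_measurable_induct_real)
    case (set A)
    then have "A \<inter> space \<mu> = A" using sets.sets_into_space by blast
    with set le show ?case by (simp add: sp)
  next
    case (mult f b)
    show ?case
    proof (cases "b = 0")
      case False
      show ?thesis
      proof (intro allI impI)
        fix K assume "\<forall>x\<in>space \<mu>. b * f x \<le> K"
        then have "\<forall>x\<in>space \<mu>. f x \<le> K / b" using mult(1) False by (auto simp: field_simps)
        with mult(4) have "(\<Sum>i\<in>UNIV. e i * ((LINT x|P i. f x) - (LINT x|N i. f x))) \<le> c * (LINT x|\<mu>. f x)" by blast
        from mult_left_mono[OF this mult(1)]
        show "(\<Sum>i\<in>UNIV. e i * ((LINT x|P i. b * f x) - (LINT x|N i. b * f x))) \<le> c * (LINT x|\<mu>. b * f x)"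
          by (simp add: sum_distrib_left algebra_simps)
      qed
    qed simp
  next
    case (add f g)
    show ?case
    proof (intro allI impI)
      fix K assume K: "\<forall>x\<in>space \<mu>. g x + f x \<le> K"
      have b: "f x \<le> K" "g x \<le> K" if "x \<in> space \<mu>" for x
        using bspec[OF K that] add.hyps(2)[of x] add.hyps(4)[of x] by linarith+
      have If: "integrable \<mu> f" "integrable (P i) f" "integrable (N i) f" for i
        using add b fin sets by (auto intro!: I[of _ f K])
      have Ig: "integrable \<mu> g" "integrable (P i) g" "integrable (N i) g" for i
        using add b fin sets by (auto intro!: I[of _ g K])
      have "(\<Sum>i\<in>UNIV. e i * ((LINT x|P i. f x) - (LINT x|N i. f x))) \<le> c * (LINT x|\<mu>. f x)"
        "(\<Sum>i\<in>UNIV. e i * ((LINT x|P i. g x) - (LINT x|N i. g x))) \<le> c * (LINT x|\<mu>. g x)"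
        using add.IH b by blast+
      from add_mono[OF this]
      show "(\<Sum>i\<in>UNIV. e i * ((LINT x|P i. g x + f x) - (LINT x|N i. g x + f x))) \<le> c * (LINT x|\<mu>. g x + f x)"
        using If Ig by (simp add: sum.distrib[symmetric] algebra_simps)
    qed
  next
    case (seq U)
    show ?case
    proof (intro allI impI)
      fix K assume K: "\<forall>x\<in>space \<mu>. \<phi> x \<le> K"
      have b: "U n x \<le> K" if "x \<in> space \<mu>" for n x
      proof -
        have "U n x \<le> \<phi> x"
          using seq.hyps(3) seq.hyps(4)[OF that] by (intro incseq_le) (auto simp: incseq_def le_fun_def)
        with K that show ?thesis by fastforce
      qed
      have lim: "(\<lambda>n. LINT x|\<nu>. U n x) \<longlonglongrightarrow> (LINT x|\<nu>. \<phi> x)"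
        if "finite_measure \<nu>" "sets \<nu> = sets \<mu>" for \<nu>
      proof (rule integral_dominated_convergence)
        interpret finite_measure \<nu> by fact
        have sp: "space \<nu> = space \<mu>" by (rule sets_eq_imp_space_eq[OF that(2)])
        show "\<phi> \<in> borel_measurable \<nu>" "U n \<in> borel_measurable \<nu>" for n
          using \<phi>(1) seq(1) measurable_cong_sets[OF that(2) refl] by blast+
        show "integrable \<nu> (\<lambda>x. K)" by simp
        show "AE x in \<nu>. (\<lambda>i. U i x) \<longlonglongrightarrow> \<phi> x" using seq.hyps(4) by (auto simp: sp)
        show "AE x in \<nu>. norm (U n x) \<le> K" for n using seq(2) b by (auto simp: sp)
      qed
      show "(\<Sum>i\<in>UNIV. e i * ((LINT x|P i. \<phi> x) - (LINT x|N i. \<phi> x))) \<le> c * (LINT x|\<mu>. \<phi> x)"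
      proof (rule LIMSEQ_le)
        show "(\<lambda>n. \<Sum>i\<in>UNIV. e i * ((LINT x|P i. U n x) - (LINT x|N i. U n x))) \<longlonglongrightarrow>
            (\<Sum>i\<in>UNIV. e i * ((LINT x|P i. \<phi> x) - (LINT x|N i. \<phi> x)))"
          by (intro tendsto_intros lim fin sets)
        show "(\<lambda>n. c * (LINT x|\<mu>. U n x)) \<longlonglongrightarrow> c * (LINT x|\<mu>. \<phi> x)"
          by (intro tendsto_intros lim fin refl)
        show "\<exists>N'. \<forall>n\<ge>N'. (\<Sum>i\<in>UNIV. e i * ((LINT x|P i. U n x) - (LINT x|N i. U n x))) \<le> c * (LINT x|\<mu>. U n x)"
          using seq.IH b by blast
      qed
    qed
  qed
  with \<phi>(3) show ?thesis by blast
qed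

text \<open>Finiteness: the Euclidean norm is at most the sum of absolute components, so every
  partition sum is bounded by the total masses of the \<open>P i\<close> and \<open>N i\<close>. The
  lower bound is the partition of \<open>B\<close> into itself and empty sets.\<close>

lemma total_variation_bounds:
  fixes P N :: "'n::finite \<Rightarrow> (real ^ 'n) measure"
  assumes fin: "\<And>i. finite_measure (P i)" "\<And>i. finite_measure (N i)"
    and sets: "\<And>i. sets (P i) = \<B>" "\<And>i. sets (N i) = \<B>" "sets \<mu> = \<B>"
    and \<mu>: "\<And>B. B \<in> \<B> \<Longrightarrow> emeasure \<mu> B =
           (SUP E\<in>{E :: nat \<Rightarrow> (real ^ 'n) set. range E \<subseteq> \<B> \<and> disjoint_family E \<and> (\<Union>k. E k) = B}.
              \<Sum>k. ennreal (norm (\<chi> i. measure (P i) (E k) - measure (N i) (E k))))"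
  shows "finite_measure \<mu>"
    and "\<And>B. B \<in> \<B> \<Longrightarrow> norm (\<chi> i. measure (P i) B - measure (N i) B) \<le> measure \<mu> B"
proof -
  have le: "emeasure \<mu> B \<le> (\<Sum>i\<in>UNIV. emeasure (P i) B + emeasure (N i) B)" if "B \<in> \<B>" for B
    unfolding \<mu>[OF that]
  proof (rule SUP_least, clarify)
    fix E :: "nat \<Rightarrow> (real ^ 'n) set"
    assume E: "range E \<subseteq> \<B>" "disjoint_family E"
    have "(\<Sum>k. ennreal (norm (\<chi> i. measure (P i) (E k) - measure (N i) (E k)))) \<le>
        (\<Sum>k. \<Sum>i\<in>UNIV. emeasure (P i) (E k) + emeasure (N i) (E k))"
    proof (rule suminf_le)
      fix k
      have "norm (\<chi> i. measure (P i) (E k) - measure (N i) (E k)) \<le> (\<Sum>i\<in>UNIV. \<bar>measure (P i) (E k) - measure (N i) (E k)\<bar>)"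
        using norm_le_l1_cart[of "\<chi> i. measure (P i) (E k) - measure (N i) (E k)"] by simp
      also have "\<dots> \<le> (\<Sum>i\<in>UNIV. measure (P i) (E k) + measure (N i) (E k))"
        by (intro sum_mono) (simp add: abs_le_iff add_increasing)
      finally have "ennreal (norm (\<chi> i. measure (P i) (E k) - measure (N i) (E k))) \<le>
          ennreal (\<Sum>i\<in>UNIV. measure (P i) (E k) + measure (N i) (E k))" by (rule ennreal_leI)
      also have "\<dots> = (\<Sum>i\<in>UNIV. emeasure (P i) (E k) + emeasure (N i) (E k))"
        using fin by (simp add: sum_ennreal[symmetric] finite_measure.emeasure_eq_measure)
      finally show "ennreal (norm (\<chi> i. measure (P i) (E k) - measure (N i) (E k))) \<le>
          (\<Sum>i\<in>UNIV. emeasure (P i) (E k) + emeasure (N i) (E k))" .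
    qed auto
    also have "\<dots> = (\<Sum>i\<in>UNIV. (\<Sum>k. emeasure (P i) (E k)) + (\<Sum>k. emeasure (N i) (E k)))"
      by (subst suminf_sum) (auto intro!: sum.cong suminf_add[symmetric])
    also have "\<dots> = (\<Sum>i\<in>UNIV. emeasure (P i) (\<Union>(range E)) + emeasure (N i) (\<Union>(range E)))"
      using E sets by (simp add: suminf_emeasure)
    finally show "(\<Sum>k. ennreal (norm (\<chi> i. measure (P i) (E k) - measure (N i) (E k)))) \<le>
        (\<Sum>i\<in>UNIV. emeasure (P i) (\<Union>(range E)) + emeasure (N i) (\<Union>(range E)))" .
  qed
  show f: "finite_measure \<mu>"
  proof (rule finite_measureI)
    have "emeasure \<mu> (space \<mu>) \<le> (\<Sum>i\<in>UNIV. emeasure (P i) (space \<mu>) + emeasure (N i) (space \<mu>))"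
      using sets(3) by (intro le) auto
    also have "\<dots> < \<infinity>"
      using fin by (simp add: finite_measure.emeasure_eq_measure)
    finally show "emeasure \<mu> (space \<mu>) \<noteq> \<infinity>" by simp
  qed
  fix B assume B: "B \<in> \<B>"
  define E where "E k = (if k = 0 then B else {})" for k :: nat
  have "{} \<in> \<B>" using sets(3) by auto
  with B have E: "range E \<subseteq> \<B>" "disjoint_family E" "(\<Union>k. E k) = B"
    by (auto simp: E_def disjoint_family_on_def split: if_splits)
  have "ennreal (norm (\<chi> i. measure (P i) B - measure (N i) B)) = ennreal (norm (\<chi> i. measure (P i) (E 0) - measure (N i) (E 0)))"
    by (simp add: E_def)
  also have "\<dots> \<le> (\<Sum>k. ennreal (norm (\<chi> i. measure (P i) (E k) - measure (N i) (E k))))"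
  proof -
    have "(\<Sum>k\<in>{0}. ennreal (norm (\<chi> i. measure (P i) (E k) - measure (N i) (E k)))) \<le>
        (\<Sum>k. ennreal (norm (\<chi> i. measure (P i) (E k) - measure (N i) (E k))))"
      by (rule sum_le_suminf) auto
    then show ?thesis by simp
  qed
  also have "\<dots> \<le> emeasure \<mu> B"
    unfolding \<mu>[OF B] using E by (intro SUP_upper) auto
  also have "\<dots> = ennreal (measure \<mu> B)" using f by (simp add: finite_measure.emeasure_eq_measure)
  finally show "norm (\<chi> i. measure (P i) B - measure (N i) B) \<le> measure \<mu> B" by simp
qed

section \<open>The pairing\<close>

text \<open>The vectors violating the inequality form an open set, which would meet \<open>D\<close>
  if it were nonempty. Hence the inequality holds for every vector, in particular for
  \<open>g\<close> itself.\<close>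

lemma dense_inner_ge:
  fixes g :: "'a::euclidean_space"
  assumes D: "\<And>X. open X \<Longrightarrow> X \<noteq> {} \<Longrightarrow> \<exists>d\<in>D. d \<in> (X :: 'a set)"
    and le: "\<And>e. e \<in> D \<Longrightarrow> e \<bullet> g \<le> norm e * s"
  shows "norm g \<le> s"
proof -
  have "open {e. norm e * s < e \<bullet> g}" by (intro open_Collect_less continuous_intros)
  moreover have "\<not> (\<exists>d\<in>D. d \<in> {e. norm e * s < e \<bullet> g})" using le by fastforce
  ultimately have "{e. norm e * s < e \<bullet> g} = {}" using D by blast
  then have all: "e \<bullet> g \<le> norm e * s" for e by (auto simp: not_less)
  show ?thesis
  proof (cases "g = 0")
    case False
    have "norm g * norm g \<le> norm g * s" using all[of g] by (simp add: power2_norm_eq_inner[symmetric] power2_eq_square)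
    with False show ?thesis by simp
  next
    case True
    \<comment> \<open>For \<open>g = 0\<close> the choice of \<open>g\<close> as test vector is
      void; a unit vector yields 0 <= s.\<close>
    obtain b :: 'a where "b \<in> Basis" using nonempty_Basis by blast
    with all[of b] True show ?thesis by simp
  qed
qed

context weight
begin

lemma integrable_bounded_inner:
  fixes z F :: "real ^ 'n \<Rightarrow> real ^ 'n"
  assumes "integrable M F" "z \<in> borel_measurable M" "AE x in M. norm (z x) \<le> B"
  shows "integrable M (\<lambda>x. z x \<bullet> F x)"
proof (rule integrable_dominated[OF assms(1)])
  show "(\<lambda>x. z x \<bullet> F x) \<in> borel_measurable M" using assms by measurable
  show "AE x in M. norm (z x \<bullet> F x) \<le> B * norm (F x)"
    using assms(3)
  proof eventually_elim
    fix x assume "norm (z x) \<le> B"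
    then have "norm (z x) * norm (F x) \<le> B * norm (F x)" by (intro mult_right_mono) auto
    with Cauchy_Schwarz_ineq2[of "z x" "F x"] show "norm (z x \<bullet> F x) \<le> B * norm (F x)" by simp
  qed
qed

lemma integrable_bounded_scaleR:
  fixes f :: "real ^ 'n \<Rightarrow> real" and F :: "real ^ 'n \<Rightarrow> 'b::euclidean_space"
  assumes "f \<in> borel_measurable M" "F \<in> borel_measurable M"
    and "integrable M f \<and> (AE x in M. norm (F x) \<le> B) \<or> integrable M F \<and> (AE x in M. \<bar>f x\<bar> \<le> B)"
  shows "integrable M (\<lambda>x. f x *\<^sub>R F x)"
proof -
  have m: "(\<lambda>x. f x *\<^sub>R F x) \<in> borel_measurable M" using assms(1,2) by measurable
  from assms(3) show ?thesis
  proof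
    assume *: "integrable M f \<and> (AE x in M. norm (F x) \<le> B)"
    then have "AE x in M. norm (f x *\<^sub>R F x) \<le> B * norm (f x)"
      by (auto elim!: eventually_mono simp: mult.commute[of B] intro!: mult_left_mono)
    with * show ?thesis using integrable_dominated[OF _ m] by blast
  next
    assume *: "integrable M F \<and> (AE x in M. \<bar>f x\<bar> \<le> B)"
    then have "AE x in M. norm (f x *\<^sub>R F x) \<le> B * norm (F x)"
      by (auto elim!: eventually_mono intro!: mult_right_mono)
    with * show ?thesis using integrable_dominated[OF _ m] by blast
  qed
qed

text \<open>As |z| is at most 1, the error is bounded by the L^1 distance of the fields.\<close>

lemma integral_inner_tendsto:
  fixes z F :: "real ^ 'n \<Rightarrow> real ^ 'n"
  assumes z: "z \<in> borel_measurable M" "AE x in M. norm (z x) \<le> 1"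
    and F: "integrable M F" "\<And>k. integrable M (F' k)"
    and lim: "(\<lambda>k. LINT x|M. norm (F' k x - F x)) \<longlonglongrightarrow> 0"
  shows "(\<lambda>k. LINT x|M. z x \<bullet> F' k x) \<longlonglongrightarrow> (LINT x|M. z x \<bullet> F x)"
proof (rule Lim_null_comparison[THEN LIM_zero_cancel, OF always_eventually lim], rule allI)
  fix k
  have I: "integrable M (\<lambda>x. F' k x - F x)" using F by auto
  have "(LINT x|M. z x \<bullet> F' k x) - (LINT x|M. z x \<bullet> F x) = (LINT x|M. z x \<bullet> (F' k x - F x))"
    using integrable_bounded_inner[OF F(1) z] integrable_bounded_inner[OF F(2) z] by (simp add: inner_diff_right)
  also have "norm \<dots> \<le> (LINT x|M. norm (z x \<bullet> (F' k x - F x)))" by (rule integral_norm_bound)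
  also have "\<dots> \<le> (LINT x|M. norm (F' k x - F x))"
  proof (rule integral_mono_AE)
    show "AE x in M. norm (z x \<bullet> (F' k x - F x)) \<le> norm (F' k x - F x)"
      using z(2)
    proof eventually_elim
      fix x assume "norm (z x) \<le> 1"
      then have "norm (z x) * norm (F' k x - F x) \<le> 1 * norm (F' k x - F x)" by (intro mult_right_mono) auto
      with Cauchy_Schwarz_ineq2[of "z x" "F' k x - F x"] show "norm (z x \<bullet> (F' k x - F x)) \<le> norm (F' k x - F x)" by simp
    qed
  qed (use I integrable_bounded_inner[OF I z] in auto)
  finally show "norm ((LINT x|M. z x \<bullet> F' k x) - (LINT x|M. z x \<bullet> F x)) \<le> (LINT x|M. norm (F' k x - F x))" .
qed

text \<open>Both cases of \<open>div_value\<close> are computed on test functions whose gradients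
  tend in L^1 to \<open>H\<close>, the weak gradient of \<open>u * \<phi>\<close>. For bounded
  divergence they are built from approximants of \<open>u\<close>; otherwise the definition supplies
  them.\<close>

lemma div_value_eq:
  assumes u: "in_W0 \<Omega> a q u" and z: "z \<in> borel_measurable M" "AE x in M. norm (z x) \<le> 1"
    and \<phi>: "test_fun \<Omega> \<phi>" and c: "div_value \<Omega> z (\<lambda>x. u x * \<phi> x) c"
  shows "c = - (LINT x|M. z x \<bullet> (\<phi> x *\<^sub>R wgrad \<Omega> u x + u x *\<^sub>R grad \<phi> x))"
proof -
  define G where "G = wgrad \<Omega> u"
  define H where "H x = \<phi> x *\<^sub>R G x + u x *\<^sub>R grad \<phi> x" for x
  have uG: "integrable M u" "integrable M G" "is_weak_grad \<Omega> u G"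
    using u is_weak_grad_wgrad in_L_integrable by (auto simp: in_W0_def in_W_def G_def)
  obtain B where B: "0 < B" "\<And>x. \<bar>\<phi> x\<bar> \<le> B" "\<And>x. norm (grad \<phi> x) \<le> B" using test_fun_bounded[OF \<phi>] by metis
  note \<phi>m = test_fun_measurable[OF \<phi>]
  have H: "integrable M H" unfolding H_def
    using uG(1,2) \<phi>m B by (intro Bochner_Integration.integrable_add integrable_bounded_scaleR[of _ _ B]) auto
  have wH: "is_weak_grad \<Omega> (\<lambda>x. u x * \<phi> x) H"
    unfolding H_def by (rule is_weak_grad_mult[OF op uG(3) \<phi>])
  have test_int: "integrable M (grad \<psi>)" "integrable M \<psi>" if "test_fun \<Omega> \<psi>" for \<psi>
    using in_L_integrable test_fun_in_L[OF that] by auto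
  show ?thesis
  proof (cases "\<exists>g. is_Linfty_div \<Omega> z g")
    case True
    with c obtain g where g: "is_Linfty_div \<Omega> z g" and cg: "c = (LINT x|M. u x * \<phi> x * g x)"
      by (auto simp: div_value_def)
    obtain B' where gm: "g \<in> borel_measurable M" and B': "AE x in M. norm (g x) \<le> B'"
      using g by (auto simp: is_Linfty_div_def Linfty_def)
    obtain \<Phi> where \<Phi>: "\<And>k. test_fun \<Omega> (\<Phi> k)"
      "\<And>k. in_L \<Omega> a q (\<lambda>x. u x - \<Phi> k x)" "\<And>k. in_L \<Omega> a q (\<lambda>x. wgrad \<Omega> u x - grad (\<Phi> k) x)"
      "(\<lambda>k. norm_L \<Omega> a q (\<lambda>x. u x - \<Phi> k x)) \<longlonglongrightarrow> 0"
      "(\<lambda>k. norm_L \<Omega> a q (\<lambda>x. wgrad \<Omega> u x - grad (\<Phi> k) x)) \<longlonglongrightarrow> 0"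
      using in_W0_approx[OF u] by blast
    \<comment> \<open>Multiplying the approximants of \<open>u\<close> by \<phi> gives approximants
      of \<open>u * \<phi>\<close>: by the product rule the gradient error is controlled through the
      bound \<open>B\<close> on \<phi> and its gradient.\<close>
    have t: "test_fun \<Omega> (\<lambda>x. \<Phi> k x * \<phi> x)" for k by (rule test_fun_mult[OF \<Phi>(1) \<phi>])
    have e0: "(\<lambda>k. LINT x|M. norm (u x - \<Phi> k x)) \<longlonglongrightarrow> 0" by (rule L1_tendsto[OF \<Phi>(2,4)])
    have e1: "(\<lambda>k. LINT x|M. norm (G x - grad (\<Phi> k) x)) \<longlonglongrightarrow> 0"
      unfolding G_def by (rule L1_tendsto[OF \<Phi>(3,5)])
    have I0: "integrable M (\<lambda>x. u x - \<Phi> k x)" and I1: "integrable M (\<lambda>x. G x - grad (\<Phi> k) x)" for k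
      using in_L_integrable[OF \<Phi>(2)] in_L_integrable[OF \<Phi>(3)] by (auto simp: G_def)
    have "(\<lambda>k. LINT x|M. norm (grad (\<lambda>x. \<Phi> k x * \<phi> x) x - H x)) \<longlonglongrightarrow> 0"
    proof (rule tendsto_sandwich[OF _ _ tendsto_const])
      show "(\<lambda>k. B * (LINT x|M. norm (u x - \<Phi> k x)) + B * (LINT x|M. norm (G x - grad (\<Phi> k) x))) \<longlonglongrightarrow> 0"
        using tendsto_add[OF tendsto_mult_left[OF e0, of B] tendsto_mult_left[OF e1, of B]] by simp
      show "\<forall>\<^sub>F k in sequentially. (LINT x|M. norm (grad (\<lambda>x. \<Phi> k x * \<phi> x) x - H x)) \<le>
          B * (LINT x|M. norm (u x - \<Phi> k x)) + B * (LINT x|M. norm (G x - grad (\<Phi> k) x))"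
      proof (rule always_eventually, rule allI)
        fix k
        have "(LINT x|M. norm (grad (\<lambda>x. \<Phi> k x * \<phi> x) x - H x)) \<le>
            (LINT x|M. B * norm (u x - \<Phi> k x) + B * norm (G x - grad (\<Phi> k) x))"
        proof (rule integral_mono)
          show "integrable M (\<lambda>x. norm (grad (\<lambda>x. \<Phi> k x * \<phi> x) x - H x))"
            using test_int(1)[OF t] H by auto
          show "integrable M (\<lambda>x. B * norm (u x - \<Phi> k x) + B * norm (G x - grad (\<Phi> k) x))"
            using I0 I1 by auto
          fix x
          have "grad (\<lambda>x. \<Phi> k x * \<phi> x) x = \<Phi> k x *\<^sub>R grad \<phi> x + \<phi> x *\<^sub>R grad (\<Phi> k) x"
            by (intro grad_mult test_fun_differentiable[OF \<Phi>(1)] test_fun_differentiable[OF \<phi>])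
          then have "H x - grad (\<lambda>x. \<Phi> k x * \<phi> x) x = (u x - \<Phi> k x) *\<^sub>R grad \<phi> x + \<phi> x *\<^sub>R (G x - grad (\<Phi> k) x)"
            by (simp add: H_def algebra_simps)
          then have "norm (H x - grad (\<lambda>x. \<Phi> k x * \<phi> x) x) \<le>
              \<bar>u x - \<Phi> k x\<bar> * norm (grad \<phi> x) + \<bar>\<phi> x\<bar> * norm (G x - grad (\<Phi> k) x)"
            using norm_triangle_ineq[of "(u x - \<Phi> k x) *\<^sub>R grad \<phi> x" "\<phi> x *\<^sub>R (G x - grad (\<Phi> k) x)"] by simp
          also have "\<dots> \<le> \<bar>u x - \<Phi> k x\<bar> * B + B * norm (G x - grad (\<Phi> k) x)"
            using B by (intro add_mono mult_mono) auto
          finally show "norm (grad (\<lambda>x. \<Phi> k x * \<phi> x) x - H x) \<le> B * norm (u x - \<Phi> k x) + B * norm (G x - grad (\<Phi> k) x)"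
            by (simp add: norm_minus_commute mult.commute)
        qed
        also have "\<dots> = B * (LINT x|M. norm (u x - \<Phi> k x)) + B * (LINT x|M. norm (G x - grad (\<Phi> k) x))"
          using I0 I1 by (subst Bochner_Integration.integral_add) auto
        finally show "(LINT x|M. norm (grad (\<lambda>x. \<Phi> k x * \<phi> x) x - H x)) \<le>
            B * (LINT x|M. norm (u x - \<Phi> k x)) + B * (LINT x|M. norm (G x - grad (\<Phi> k) x))" .
      qed
    qed simp
    from integral_inner_tendsto[OF z H test_int(1)[OF t] this]
    have L1: "(\<lambda>k. LINT x|M. z x \<bullet> grad (\<lambda>x. \<Phi> k x * \<phi> x) x) \<longlonglongrightarrow> (LINT x|M. z x \<bullet> H x)" .
    have eq: "(LINT x|M. z x \<bullet> grad (\<lambda>x. \<Phi> k x * \<phi> x) x) = - (LINT x|M. g x * (\<Phi> k x * \<phi> x))" for k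
      using g t[of k] by (auto simp: is_Linfty_div_def distr_div_def)
    have bg: "AE x in M. norm (\<phi> x * g x) \<le> B * B'"
      using B'
    proof eventually_elim
      show "norm (\<phi> x * g x) \<le> B * B'" if "norm (g x) \<le> B'" for x
        using that B(1) B(2)[of x] by (simp add: abs_mult mult_mono)
    qed
    have Ig: "integrable M (\<lambda>x. h x * (\<phi> x * g x))" if "integrable M h" for h :: "real ^ 'n \<Rightarrow> real"
      using integrable_bounded_scaleR[of h "\<lambda>x. \<phi> x * g x" "B * B'"] that bg gm \<phi>m by auto
    have "(\<lambda>k. LINT x|M. \<Phi> k x * (\<phi> x * g x)) \<longlonglongrightarrow> (LINT x|M. u x * (\<phi> x * g x))"
    proof (rule Lim_null_comparison[THEN LIM_zero_cancel, OF always_eventually], rule allI)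
      show "(\<lambda>k. B * B' * (LINT x|M. norm (u x - \<Phi> k x))) \<longlonglongrightarrow> 0"
        using tendsto_mult_left[OF e0, of "B * B'"] by simp
      fix k
      \<comment> \<open>On this side \<phi> and \<open>g\<close> are bounded, so L^1 convergence of
        the functions alone suffices.\<close>
      have "(LINT x|M. \<Phi> k x * (\<phi> x * g x)) - (LINT x|M. u x * (\<phi> x * g x)) = (LINT x|M. (\<Phi> k x - u x) * (\<phi> x * g x))"
        using Ig[OF test_int(2)[OF \<Phi>(1)]] Ig[OF uG(1)] by (simp add: left_diff_distrib)
      also have "norm \<dots> \<le> (LINT x|M. norm ((\<Phi> k x - u x) * (\<phi> x * g x)))" by (rule integral_norm_bound)
      also have "\<dots> \<le> (LINT x|M. B * B' * norm (u x - \<Phi> k x))"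
      proof (rule integral_mono_AE)
        have "integrable M (\<lambda>x. \<Phi> k x - u x)" using test_int(2)[OF \<Phi>(1)] uG by auto
        from Ig[OF this] show "integrable M (\<lambda>x. norm ((\<Phi> k x - u x) * (\<phi> x * g x)))" by (rule integrable_norm)
        show "integrable M (\<lambda>x. B * B' * norm (u x - \<Phi> k x))" using I0 by auto
        show "AE x in M. norm ((\<Phi> k x - u x) * (\<phi> x * g x)) \<le> B * B' * norm (u x - \<Phi> k x)"
          using bg
        proof eventually_elim
          fix x assume "norm (\<phi> x * g x) \<le> B * B'"
          then have "norm (u x - \<Phi> k x) * norm (\<phi> x * g x) \<le> norm (u x - \<Phi> k x) * (B * B')"
            by (intro mult_left_mono) auto
          then show "norm ((\<Phi> k x - u x) * (\<phi> x * g x)) \<le> B * B' * norm (u x - \<Phi> k x)"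
            by (simp only: norm_mult norm_minus_commute[of "\<Phi> k x"] mult.commute[of "B * B'"])
        qed
      qed
      finally show "norm ((LINT x|M. \<Phi> k x * (\<phi> x * g x)) - (LINT x|M. u x * (\<phi> x * g x))) \<le> B * B' * (LINT x|M. norm (u x - \<Phi> k x))"
        by simp
    qed
    then have "(\<lambda>k. LINT x|M. z x \<bullet> grad (\<lambda>x. \<Phi> k x * \<phi> x) x) \<longlonglongrightarrow> - c"
      unfolding eq cg by (intro tendsto_minus) (simp add: mult_ac)
    then have "- c = (LINT x|M. z x \<bullet> H x)" using L1 by (rule LIMSEQ_unique)
    then show ?thesis by (simp add: H_def G_def)
  next
    case False
    with c obtain \<Phi> where \<Phi>: "\<And>k. test_fun \<Omega> (\<Phi> k)"
        "(\<lambda>k. norm_W \<Omega> (\<lambda>_. 1) 1 (\<lambda>x. u x * \<phi> x - \<Phi> k x)) \<longlonglongrightarrow> 0" "(\<lambda>k. distr_div \<Omega> z (\<Phi> k)) \<longlonglongrightarrow> c"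
      by (auto simp: div_value_def)
    \<comment> \<open>With weight 1 and exponent 1 the gradient part of \<open>norm_W\<close> is an
      L^1 norm, and uniqueness of weak gradients identifies its integrand.\<close>
    have "(LINT x|M. norm (grad (\<Phi> k) x - H x)) \<le> norm_W \<Omega> (\<lambda>_. 1) 1 (\<lambda>x. u x * \<phi> x - \<Phi> k x)" for k
    proof -
      let ?h = "\<lambda>x. u x * \<phi> x - \<Phi> k x"
      have "is_weak_grad \<Omega> ?h (\<lambda>x. H x - grad (\<Phi> k) x)"
        by (rule is_weak_grad_diff[OF op wH is_weak_grad_test_fun[OF op \<Phi>(1)]])
      then have ae: "AE x in M. H x - grad (\<Phi> k) x = wgrad \<Omega> ?h x"
        using is_weak_grad_wgrad is_weak_grad_unique[OF op] by blast
      have m: "(\<lambda>x. H x - grad (\<Phi> k) x) \<in> borel_measurable M"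
        using H test_fun_measurable[OF \<Phi>(1)] by auto
      have "(LINT x|M. norm (grad (\<Phi> k) x - H x)) = (LINT x|M. norm (wgrad \<Omega> ?h x))"
      proof (rule integral_cong_AE)
        show "AE x in M. norm (grad (\<Phi> k) x - H x) = norm (wgrad \<Omega> ?h x)"
          using ae by eventually_elim (metis norm_minus_commute)
        show "(\<lambda>x. norm (wgrad \<Omega> ?h x)) \<in> borel_measurable M"
          using AE_measurable_lebesgue_on[OF op m ae] by measurable
        show "(\<lambda>x. norm (grad (\<Phi> k) x - H x)) \<in> borel_measurable M"
          using m by (simp add: norm_minus_commute[of "grad (\<Phi> k) _"])
      qed
      then show ?thesis by (simp add: norm_W_def norm_L_def powr_one_gt_zero_iff)
    qed
    then have "(\<lambda>k. LINT x|M. norm (grad (\<Phi> k) x - H x)) \<longlonglongrightarrow> 0"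
      by (intro tendsto_sandwich[OF _ _ tendsto_const \<Phi>(2)] always_eventually) auto
    from tendsto_minus[OF integral_inner_tendsto[OF z H test_int(1)[OF \<Phi>(1)] this]]
    have "(\<lambda>k. distr_div \<Omega> z (\<Phi> k)) \<longlonglongrightarrow> - (LINT x|M. z x \<bullet> H x)" by (simp add: distr_div_def)
    with \<Phi>(3) have "c = - (LINT x|M. z x \<bullet> H x)" by (rule LIMSEQ_unique)
    then show ?thesis by (simp add: H_def G_def)
  qed
qed

text \<open>After \<open>div_value_eq\<close> the two integrals of \<open>u\<close> times z . grad
  \<phi> cancel, which leaves z . grad u as the density of the pairing.\<close>

lemma pairing_value_eq:
  assumes u: "in_W0 \<Omega> a q u" and z: "z \<in> borel_measurable M" "AE x in M. norm (z x) \<le> 1"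
    and \<phi>: "test_fun \<Omega> \<phi>" and t: "pairing_value \<Omega> z u \<phi> t"
  shows "t = (LINT x|M. (z x \<bullet> wgrad \<Omega> u x) * \<phi> x)"
proof -
  have uG: "integrable M u" "integrable M (wgrad \<Omega> u)"
    using u in_L_integrable by (auto simp: in_W0_def in_W_def)
  obtain B where B: "0 < B" "\<And>x. \<bar>\<phi> x\<bar> \<le> B" "\<And>x. norm (grad \<phi> x) \<le> B" using test_fun_bounded[OF \<phi>] by metis
  note \<phi>m = test_fun_measurable[OF \<phi>]
  have I: "integrable M (\<lambda>x. z x \<bullet> (\<phi> x *\<^sub>R wgrad \<Omega> u x))" "integrable M (\<lambda>x. z x \<bullet> (u x *\<^sub>R grad \<phi> x))"
    using uG \<phi>m B by (intro integrable_bounded_inner[OF _ z] integrable_bounded_scaleR[where B=B]; auto)+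
  obtain c where c: "div_value \<Omega> z (\<lambda>x. u x * \<phi> x) c" and tc: "t = - (LINT x|M. u x * (z x \<bullet> grad \<phi> x)) - c"
    using t by (auto simp: pairing_value_def)
  have "t = - (LINT x|M. z x \<bullet> (u x *\<^sub>R grad \<phi> x)) +
      (LINT x|M. z x \<bullet> (\<phi> x *\<^sub>R wgrad \<Omega> u x) + z x \<bullet> (u x *\<^sub>R grad \<phi> x))"
    unfolding tc div_value_eq[OF u z \<phi> c] by (simp add: inner_add_right)
  also have "\<dots> = (LINT x|M. z x \<bullet> (\<phi> x *\<^sub>R wgrad \<Omega> u x))"
    using I by (subst Bochner_Integration.integral_add) auto
  finally show ?thesis by (simp add: mult.commute)
qed

section \<open>From equality of measures to a pointwise inequality\<close>

lemma integrable_locally_integrable: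
  fixes g :: "real ^ 'n \<Rightarrow> 'b::euclidean_space"
  assumes "integrable M g" shows "locally_integrable \<Omega> g"
  unfolding locally_integrable_def
proof (intro allI impI)
  fix K assume K: "compact K \<and> K \<subseteq> \<Omega>"
  have "set_integrable lebesgue \<Omega> g" using assms op by (simp add: set_integrable_lebesgue_on)
  then have "set_integrable lebesgue K g"
    using K by (elim set_integrable_subset) (auto intro: lmeasurable_compact fmeasurableD)
  then show "integrable (lebesgue_on K) g"
    using K by (simp add: set_integrable_lebesgue_on lmeasurable_compact fmeasurableD)
qed

text \<open>The measure \<open>|Du|\<close> dominates \<open>e \<cdot> Du\<close> for every unit vector \<open>e\<close>, so the pairing condition
  yields \<open>z \<cdot> \<nabla>u \<ge> e \<cdot> \<nabla>u\<close>, first for \<open>e\<close> in a countable dense set.\<close>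

lemma pairing_eq_norm:
  assumes u: "in_W0 \<Omega> a q u" and z: "z \<in> borel_measurable M" "AE x in M. norm (z x) \<le> 1"
    and \<mu>: "is_abs_D \<Omega> u \<mu>" and pair: "\<And>\<phi>. test_fun \<Omega> \<phi> \<Longrightarrow> pairing_value \<Omega> z u \<phi> (LINT x|\<mu>. \<phi> x)"
  shows "AE x in M. norm (wgrad \<Omega> u x) \<le> z x \<bullet> wgrad \<Omega> u x"
proof -
  define G where "G = wgrad \<Omega> u"
  have uG: "integrable M G" "is_weak_grad \<Omega> u G"
    using u is_weak_grad_wgrad in_L_integrable by (auto simp: in_W0_def in_W_def G_def)
  have zG: "integrable M (\<lambda>x. z x \<bullet> G x)" by (rule integrable_bounded_inner[OF uG(1) z])
  obtain P N where PN: "is_D \<Omega> u P N" and sets_\<mu>: "sets \<mu> = borel_on \<Omega>"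
    and SUP: "\<And>B. B \<in> borel_on \<Omega> \<Longrightarrow> emeasure \<mu> B =
           (SUP E\<in>{E :: nat \<Rightarrow> (real ^ 'n) set. range E \<subseteq> borel_on \<Omega> \<and> disjoint_family E \<and> (\<Union>k. E k) = B}.
              \<Sum>k. ennreal (norm (\<chi> i. measure (P i) (E k) - measure (N i) (E k))))"
    using \<mu> unfolding is_abs_D_def by blast
  have fin: "\<And>i. finite_measure (P i)" "\<And>i. finite_measure (N i)"
    and sets: "\<And>i. sets (P i) = borel_on \<Omega>" "\<And>i. sets (N i) = borel_on \<Omega>"
    and D: "\<And>\<phi> i. test_fun \<Omega> \<phi> \<Longrightarrow> (LINT x|M. u x * grad \<phi> x $ i) = - ((LINT x|P i. \<phi> x) - (LINT x|N i. \<phi> x))"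
    using PN by (auto simp: is_D_def)
  note tv = total_variation_bounds[OF fin sets sets_\<mu> SUP]
  \<comment> \<open>The factor \<open>norm e\<close> makes the inequality homogeneous, so a
    countable dense subset of the whole space can be used instead of one of the sphere.\<close>
  have ae: "AE x in M. 0 \<le> norm e * (z x \<bullet> G x) - e \<bullet> G x" for e :: "real ^ 'n"
  proof (rule AE_nonneg_if_test_fun_nonneg[OF op])
    have I: "integrable M (\<lambda>x. norm e * (z x \<bullet> G x) - e \<bullet> G x)" using zG uG(1) by auto
    show "locally_integrable \<Omega> (\<lambda>x. norm e * (z x \<bullet> G x) - e \<bullet> G x)" by (rule integrable_locally_integrable[OF I])
    fix \<phi> assume \<phi>: "test_fun \<Omega> \<phi>" "\<And>x. 0 \<le> \<phi> x"
    obtain B where B: "\<And>x. \<bar>\<phi> x\<bar> \<le> B" using test_fun_bounded[OF \<phi>(1)] by metis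
    have "(\<Sum>i\<in>UNIV. e $ i * ((LINT x|P i. \<phi> x) - (LINT x|N i. \<phi> x))) \<le> norm e * (LINT x|\<mu>. \<phi> x)"
    proof (rule integral_le_if_measure_le[OF tv(1) fin])
      show "sets (P i) = sets \<mu>" "sets (N i) = sets \<mu>" for i using sets sets_\<mu> by auto
      show "(\<Sum>i\<in>UNIV. e $ i * (measure (P i) B - measure (N i) B)) \<le> norm e * measure \<mu> B" if "B \<in> sets \<mu>" for B
      proof -
        have "(\<Sum>i\<in>UNIV. e $ i * (measure (P i) B - measure (N i) B)) = e \<bullet> (\<chi> i. measure (P i) B - measure (N i) B)"
          by (simp add: inner_vec_def)
        also have "\<dots> \<le> norm e * norm (\<chi> i. measure (P i) B - measure (N i) B)" by (rule norm_cauchy_schwarz)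
        also have "\<dots> \<le> norm e * measure \<mu> B" using tv(2)[of B] that sets_\<mu> by (intro mult_left_mono) auto
        finally show ?thesis .
      qed
      have "\<phi> \<in> borel_measurable (restrict_space borel \<Omega>)"
        using borel_measurable_continuous_onI[OF test_fun_continuous[OF \<phi>(1)]] by (rule measurable_restrict_space1)
      then show "\<phi> \<in> borel_measurable \<mu>"
        using sets_\<mu> measurable_cong_sets[of \<mu> "restrict_space borel \<Omega>" borel borel] by (simp add: borel_on_def)
      show "0 \<le> \<phi> x" "\<phi> x \<le> B" for x using \<phi>(2)[of x] B[of x] by auto
    qed
    \<comment> \<open>The measures and the weak gradient represent the same functional of \<phi>, so
      \<open>Du\<close> may be replaced by \<open>G\<close> inside test integrals.\<close>
    moreover have "(LINT x|P i. \<phi> x) - (LINT x|N i. \<phi> x) = (LINT x|M. G x $ i * \<phi> x)" for i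
      using D[OF \<phi>(1), of i] uG(2) \<phi>(1) by (simp add: is_weak_grad_def)
    moreover have "(LINT x|\<mu>. \<phi> x) = (LINT x|M. (z x \<bullet> G x) * \<phi> x)"
      unfolding G_def by (rule pairing_value_eq[OF u z \<phi>(1) pair[OF \<phi>(1)]])
    moreover have I1: "integrable M (\<lambda>x. G x $ i * \<phi> x)" for i
      by (rule locally_integrable_test_fun(1)[OF op locally_integrable_nth[OF integrable_locally_integrable[OF uG(1)]] \<phi>(1)])
    moreover have I2: "integrable M (\<lambda>x. (z x \<bullet> G x) * \<phi> x)"
      by (rule locally_integrable_test_fun(1)[OF op integrable_locally_integrable[OF zG] \<phi>(1)])
    ultimately have "0 \<le> (LINT x|M. norm e * ((z x \<bullet> G x) * \<phi> x) - (\<Sum>i\<in>UNIV. e $ i * (G x $ i * \<phi> x)))"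
      by simp
    also have "(\<lambda>x. norm e * ((z x \<bullet> G x) * \<phi> x) - (\<Sum>i\<in>UNIV. e $ i * (G x $ i * \<phi> x))) =
        (\<lambda>x. (norm e * (z x \<bullet> G x) - e \<bullet> G x) * \<phi> x)"
      by (simp add: inner_vec_def[of e] left_diff_distrib sum_distrib_right mult.assoc)
    finally show "0 \<le> (LINT x|M. (norm e * (z x \<bullet> G x) - e \<bullet> G x) * \<phi> x)" .
  qed
  obtain D :: "(real ^ 'n) set" where D: "countable D" "\<And>X. open X \<Longrightarrow> X \<noteq> {} \<Longrightarrow> \<exists>d\<in>D. d \<in> X"
    using countable_dense_exists[where 'a="real ^ 'n"] by auto
  have "AE x in M. \<forall>e\<in>D. 0 \<le> norm e * (z x \<bullet> G x) - e \<bullet> G x"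
    unfolding AE_ball_countable[OF D(1)] using ae by blast
  then show ?thesis
  proof eventually_elim
    fix x assume "\<forall>e\<in>D. 0 \<le> norm e * (z x \<bullet> G x) - e \<bullet> G x"
    then show "norm (wgrad \<Omega> u x) \<le> z x \<bullet> wgrad \<Omega> u x"
      using dense_inner_ge[OF D(2), of "G x" "z x \<bullet> G x"] by (auto simp: G_def)
  qed
qed

section \<open>Vector fields acting continuously on weighted gradients\<close>

text \<open>The dual weight \<open>f = a powr (-1/(q-1))\<close> makes the bound \<open>1\<close>, so that \<open>z\<close> and the flux
  \<open>a |\<nabla>u|\<^sup>q\<^sup>-\<^sup>2 \<nabla>u\<close> are handled alike.\<close>

definition dual :: "(real ^ 'n \<Rightarrow> real ^ 'n) \<Rightarrow> bool" where
  "dual X \<longleftrightarrow> X \<in> borel_measurable M \<and>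
     (\<exists>f :: real ^ 'n \<Rightarrow> real. in_L \<Omega> a q f \<and> (AE x in M. norm (X x) \<le> a x * norm (f x) powr (q - 1)))"

lemma dual_bounded:
  assumes "z \<in> borel_measurable M" "AE x in M. norm (z x) \<le> 1" shows "dual z"
proof -
  have "AE x in M. norm (z x) \<le> a x * norm (a x powr (- 1 / (q - 1))) powr (q - 1)"
    using assms(2) dual_weight_pairing[of "\<lambda>x. 1"] by eventually_elim simp
  with assms in_L_dual_weight show ?thesis unfolding dual_def by blast
qed

text \<open>The norm of the weak gradient of \<open>u\<close> serves as the function
  \<open>f\<close> of the definition, with equality in the bound.\<close>

lemma dual_q_flux:
  assumes "in_W0 \<Omega> a q u" shows "dual (q_flux \<Omega> a q u)"
proof -
  have G: "in_L \<Omega> a q (wgrad \<Omega> u)" using assms by (simp add: in_W0_def in_W_def)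
  then have [measurable]: "wgrad \<Omega> u \<in> borel_measurable M" "a \<in> borel_measurable M"
    using a_meas by (auto simp: in_L_def)
  have "q_flux \<Omega> a q u \<in> borel_measurable M" unfolding q_flux_def[abs_def] by measurable
  moreover have "in_L \<Omega> a q (\<lambda>x. norm (wgrad \<Omega> u x))" using G by (simp add: in_L_def)
  moreover have "AE x in M. norm (q_flux \<Omega> a q u x) \<le> a x * norm (norm (wgrad \<Omega> u x)) powr (q - 1)"
  proof (rule AE_I2)
    fix x assume "x \<in> space M"
    then show "norm (q_flux \<Omega> a q u x) \<le> a x * norm (norm (wgrad \<Omega> u x)) powr (q - 1)"
      using powr_times_self[of "norm (wgrad \<Omega> u x)" "q - 1"] a_nonneg[of x]
      by (simp add: q_flux_def abs_mult mult.assoc)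
  qed
  ultimately show ?thesis unfolding dual_def by blast
qed

text \<open>In the second claim \<open>f\<close> is chosen before the field it is paired with: a
  single \<open>f\<close> has to serve a whole sequence in \<open>pairing_tendsto\<close>.\<close>

lemma dual_integrable:
  assumes X: "dual X" and g: "in_L \<Omega> a q g"
  shows "integrable M (\<lambda>x. X x \<bullet> g x)"
    and "\<exists>f :: real ^ 'n \<Rightarrow> real. in_L \<Omega> a q f \<and> (\<forall>g. in_L \<Omega> a q g \<longrightarrow>
      \<bar>LINT x|M. X x \<bullet> g x\<bar> \<le> (LINT x|M. a x * norm (f x) powr (q - 1) * norm (g x)))"
proof -
  obtain f :: "real ^ 'n \<Rightarrow> real" where f: "in_L \<Omega> a q f" "AE x in M. norm (X x) \<le> a x * norm (f x) powr (q - 1)"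
    and Xm: "X \<in> borel_measurable M"
    using X by (auto simp: dual_def)
  have ae: "AE x in M. norm (X x \<bullet> g x) \<le> a x * norm (f x) powr (q - 1) * norm (g x)" for g :: "real ^ 'n \<Rightarrow> real ^ 'n"
    using f(2)
  proof eventually_elim
    fix x assume "norm (X x) \<le> a x * norm (f x) powr (q - 1)"
    then have "norm (X x) * norm (g x) \<le> a x * norm (f x) powr (q - 1) * norm (g x)" by (intro mult_right_mono) auto
    with Cauchy_Schwarz_ineq2[of "X x" "g x"] show "norm (X x \<bullet> g x) \<le> a x * norm (f x) powr (q - 1) * norm (g x)" by simp
  qed
  have I: "integrable M (\<lambda>x. X x \<bullet> g x)" if g: "in_L \<Omega> a q g" for g
  proof (rule integrable_dominated[OF integrable_pairing[OF f(1) g], of _ 1])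
    show "(\<lambda>x. X x \<bullet> g x) \<in> borel_measurable M" using Xm g by (auto simp: in_L_def)
    show "AE x in M. norm (X x \<bullet> g x) \<le> 1 * norm (a x * norm (f x) powr (q - 1) * norm (g x))"
      using ae[of g] by eventually_elim (metis abs_ge_self mult_1 order_trans real_norm_def)
  qed
  show "integrable M (\<lambda>x. X x \<bullet> g x)" by (rule I[OF g])
  have "\<bar>LINT x|M. X x \<bullet> g x\<bar> \<le> (LINT x|M. a x * norm (f x) powr (q - 1) * norm (g x))" if g: "in_L \<Omega> a q g" for g
  proof -
    have "\<bar>LINT x|M. X x \<bullet> g x\<bar> \<le> (LINT x|M. norm (X x \<bullet> g x))"
      using integral_norm_bound[of M "\<lambda>x. X x \<bullet> g x"] by simp
    also have "\<dots> \<le> (LINT x|M. a x * norm (f x) powr (q - 1) * norm (g x))"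
      using I[OF g] integrable_pairing[OF f(1) g] ae by (intro integral_mono_AE) auto
    finally show ?thesis .
  qed
  with f(1) show "\<exists>f :: real ^ 'n \<Rightarrow> real. in_L \<Omega> a q f \<and> (\<forall>g. in_L \<Omega> a q g \<longrightarrow>
      \<bar>LINT x|M. X x \<bullet> g x\<bar> \<le> (LINT x|M. a x * norm (f x) powr (q - 1) * norm (g x)))" by blast
qed

lemma dual_tendsto:
  assumes X: "dual X" and g: "in_L \<Omega> a q g" "\<And>k. in_L \<Omega> a q (h k)"
    and lim: "(\<lambda>k. norm_L \<Omega> a q (\<lambda>x. g x - h k x)) \<longlonglongrightarrow> 0"
  shows "(\<lambda>k. LINT x|M. X x \<bullet> h k x) \<longlonglongrightarrow> (LINT x|M. X x \<bullet> g x)"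
proof -
  note d = in_L_diff[OF g]
  obtain f :: "real ^ 'n \<Rightarrow> real" where f: "in_L \<Omega> a q f" "\<And>g. in_L \<Omega> a q g \<Longrightarrow>
      \<bar>LINT x|M. X x \<bullet> g x\<bar> \<le> (LINT x|M. a x * norm (f x) powr (q - 1) * norm (g x))"
    using dual_integrable(2)[OF X g(1)] by blast
  have "(\<lambda>k. LINT x|M. X x \<bullet> (g x - h k x)) \<longlonglongrightarrow> 0"
    by (rule Lim_null_comparison[OF always_eventually pairing_tendsto[OF f(1) d lim]]) (use f(2)[OF d] in auto)
  then have "(\<lambda>k. (LINT x|M. X x \<bullet> g x) - (LINT x|M. X x \<bullet> (g x - h k x))) \<longlonglongrightarrow> (LINT x|M. X x \<bullet> g x) - 0"
    by (intro tendsto_intros)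
  then show ?thesis
    using dual_integrable(1)[OF X g(1)] dual_integrable(1)[OF X g(2)] by (simp add: inner_diff_right)
qed

text \<open>The Poincare inequality is applied to the difference of test functions approximating
  \<open>u\<close> and \<open>v\<close>. As both gradients approximate the same field, the gradient
  of this difference tends to 0 in L^1, and the Lipschitz bound on \<open>F\<close> transfers the
  result to \<open>u - v\<close>.\<close>

lemma eq_if_wgrad_eq:
  assumes u: "in_W0 \<Omega> a q u" and v: "in_W0 \<Omega> a q v" and G: "AE x in M. wgrad \<Omega> u x = wgrad \<Omega> v x"
  shows "AE x in M. u x = v x"
proof -
  obtain \<phi> where \<phi>: "\<And>k. test_fun \<Omega> (\<phi> k)"
    "\<And>k. in_L \<Omega> a q (\<lambda>x. u x - \<phi> k x)" "\<And>k. in_L \<Omega> a q (\<lambda>x. wgrad \<Omega> u x - grad (\<phi> k) x)"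
    "(\<lambda>k. norm_L \<Omega> a q (\<lambda>x. u x - \<phi> k x)) \<longlonglongrightarrow> 0"
    "(\<lambda>k. norm_L \<Omega> a q (\<lambda>x. wgrad \<Omega> u x - grad (\<phi> k) x)) \<longlonglongrightarrow> 0"
    using in_W0_approx[OF u] by blast
  obtain \<psi> where \<psi>: "\<And>k. test_fun \<Omega> (\<psi> k)"
    "\<And>k. in_L \<Omega> a q (\<lambda>x. v x - \<psi> k x)" "\<And>k. in_L \<Omega> a q (\<lambda>x. wgrad \<Omega> v x - grad (\<psi> k) x)"
    "(\<lambda>k. norm_L \<Omega> a q (\<lambda>x. v x - \<psi> k x)) \<longlonglongrightarrow> 0"
    "(\<lambda>k. norm_L \<Omega> a q (\<lambda>x. wgrad \<Omega> v x - grad (\<psi> k) x)) \<longlonglongrightarrow> 0"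
    using in_W0_approx[OF v] by blast
  obtain R where R: "\<Omega> \<subseteq> cball 0 R" and R0: "0 \<le> R"
  proof -
    obtain b where "\<And>x. x \<in> \<Omega> \<Longrightarrow> norm x \<le> b" using bd by (auto simp: bounded_iff)
    then show ?thesis by (intro that[of "max b 0"]) (auto simp: le_max_iff_disj)
  qed
  \<comment> \<open>Any coordinate will do, as the Poincare inequality involves one partial
    derivative only.\<close>
  fix i0 :: 'n
  define s where "s x = u x - v x" for x
  define F where "F t = sqrt (1 + t\<^sup>2) - 1" for t :: real
  have F_le: "F t \<le> \<bar>t\<bar>" and F_nn: "0 \<le> F t" and F_0: "F t = 0 \<longleftrightarrow> t = 0" and F_lip: "F t \<le> F r + \<bar>t - r\<bar>" for t r
  proof -
    show "F t \<le> F r + \<bar>t - r\<bar>" for t r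
      \<comment> \<open>The triangle inequality in the plane for the vectors (1, r) and (0, t - r),
        whose sum is (1, t).\<close>
      using real_sqrt_sum_squares_triangle_ineq[of 1 0 r "t - r"] by (simp add: F_def)
    from this[of t 0] show "F t \<le> \<bar>t\<bar>" by (simp add: F_def)
  qed (auto simp: F_def)
  have Iu: "integrable M (\<lambda>x. u x - \<phi> k x)" and Iv: "integrable M (\<lambda>x. v x - \<psi> k x)"
    and IG: "integrable M (\<lambda>x. wgrad \<Omega> u x - grad (\<phi> k) x)" and IH: "integrable M (\<lambda>x. wgrad \<Omega> v x - grad (\<psi> k) x)" for k
    using in_L_integrable[OF \<phi>(2)] in_L_integrable[OF \<phi>(3)] in_L_integrable[OF \<psi>(2)] in_L_integrable[OF \<psi>(3)] by auto
  have s: "integrable M s"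
    unfolding s_def using u v in_L_integrable by (auto simp: in_W0_def in_W_def)
  have Fm: "F \<in> borel_measurable borel" unfolding F_def by measurable
  have IF: "integrable M (\<lambda>x. F (h x))" if "integrable M h" for h
    using F_le F_nn Fm measurable_compose[OF borel_measurable_integrable[OF that] Fm]
    by (intro integrable_dominated[OF that, of _ 1]) auto
  define \<eta> where "\<eta> k x = \<phi> k x - \<psi> k x" for k x
  have \<eta>: "test_fun \<Omega> (\<eta> k)" for k unfolding \<eta>_def by (rule test_fun_diff[OF \<phi>(1) \<psi>(1)])
  have I\<eta>: "integrable M (\<eta> k)" "integrable M (grad (\<eta> k))" for k
    using in_L_integrable test_fun_in_L[OF \<eta>] by auto
  let ?b = "\<lambda>k. R * ((LINT x|M. norm (wgrad \<Omega> u x - grad (\<phi> k) x)) + (LINT x|M. norm (wgrad \<Omega> v x - grad (\<psi> k) x))) +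
     ((LINT x|M. norm (u x - \<phi> k x)) + (LINT x|M. norm (v x - \<psi> k x)))"
  have "(LINT x|M. F (s x)) \<le> ?b k" for k
  proof -
    have "(LINT x|M. \<bar>grad (\<eta> k) x $ i0\<bar>) \<le> (LINT x|M. norm (wgrad \<Omega> u x - grad (\<phi> k) x) + norm (wgrad \<Omega> v x - grad (\<psi> k) x))"
    proof (rule integral_mono_AE)
      show "integrable M (\<lambda>x. \<bar>grad (\<eta> k) x $ i0\<bar>)"
        using integrable_bounded_linear[OF bounded_linear_vec_nth I\<eta>(2)] by auto
      show "integrable M (\<lambda>x. norm (wgrad \<Omega> u x - grad (\<phi> k) x) + norm (wgrad \<Omega> v x - grad (\<psi> k) x))"
        using IG IH by auto
      show "AE x in M. \<bar>grad (\<eta> k) x $ i0\<bar> \<le> norm (wgrad \<Omega> u x - grad (\<phi> k) x) + norm (wgrad \<Omega> v x - grad (\<psi> k) x)"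
        using G
      proof eventually_elim
        fix x assume eq: "wgrad \<Omega> u x = wgrad \<Omega> v x"
        have "grad (\<eta> k) x = grad (\<phi> k) x - grad (\<psi> k) x"
          unfolding \<eta>_def by (intro grad_diff test_fun_differentiable[OF \<phi>(1)] test_fun_differentiable[OF \<psi>(1)])
        then have "grad (\<eta> k) x = (wgrad \<Omega> v x - grad (\<psi> k) x) - (wgrad \<Omega> u x - grad (\<phi> k) x)"
          using eq by simp
        then have "norm (grad (\<eta> k) x) \<le> norm (wgrad \<Omega> u x - grad (\<phi> k) x) + norm (wgrad \<Omega> v x - grad (\<psi> k) x)"
          using norm_triangle_ineq4[of "wgrad \<Omega> v x - grad (\<psi> k) x" "wgrad \<Omega> u x - grad (\<phi> k) x"] by simp
        with component_le_norm_cart[of "grad (\<eta> k) x" i0]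
        show "\<bar>grad (\<eta> k) x $ i0\<bar> \<le> norm (wgrad \<Omega> u x - grad (\<phi> k) x) + norm (wgrad \<Omega> v x - grad (\<psi> k) x)" by linarith
      qed
    qed
    then have g: "(LINT x|M. F (\<eta> k x)) \<le>
        R * ((LINT x|M. norm (wgrad \<Omega> u x - grad (\<phi> k) x)) + (LINT x|M. norm (wgrad \<Omega> v x - grad (\<psi> k) x)))"
      using order_trans[OF poincare_test_fun[OF op \<eta> R, of k i0, folded F_def] mult_left_mono[OF _ R0]] IG IH by simp
    have "(LINT x|M. F (s x)) \<le> (LINT x|M. F (\<eta> k x) + (norm (u x - \<phi> k x) + norm (v x - \<psi> k x)))"
    proof (rule integral_mono)
      show "integrable M (\<lambda>x. F (s x))" by (rule IF[OF s])
      show "integrable M (\<lambda>x. F (\<eta> k x) + (norm (u x - \<phi> k x) + norm (v x - \<psi> k x)))"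
        using IF[OF I\<eta>(1)] Iu Iv by auto
      show "F (s x) \<le> F (\<eta> k x) + (norm (u x - \<phi> k x) + norm (v x - \<psi> k x))" for x
        using F_lip[of "s x" "\<eta> k x"] unfolding s_def \<eta>_def real_norm_def by linarith
    qed
    also have "\<dots> = (LINT x|M. F (\<eta> k x)) + ((LINT x|M. norm (u x - \<phi> k x)) + (LINT x|M. norm (v x - \<psi> k x)))"
      using IF[OF I\<eta>(1), of k] Iu[of k] Iv[of k] by simp
    finally show ?thesis using g by linarith
  qed
  moreover have "?b \<longlonglongrightarrow> R * (0 + 0) + (0 + 0)"
    by (intro tendsto_intros L1_tendsto[OF \<phi>(2,4)] L1_tendsto[OF \<psi>(2,4)] L1_tendsto[OF \<phi>(3,5)] L1_tendsto[OF \<psi>(3,5)])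
  ultimately have "(LINT x|M. F (s x)) \<le> R * (0 + 0) + (0 + 0)"
    by (intro LIMSEQ_le_const) auto
  moreover have "0 \<le> (LINT x|M. F (s x))" using F_nn by (intro integral_nonneg_AE) auto
  ultimately have "(LINT x|M. F (s x)) = 0" by simp
  then have "AE x in M. F (s x) = 0"
    using integral_nonneg_eq_0_iff_AE[OF IF[OF s]] F_nn by auto
  then show ?thesis by eventually_elim (auto simp: F_0 s_def)
qed

text \<open>Testing the difference of the two equations with \<open>u - v\<close>, both the \<open>1\<close>-Laplace part and the
  weighted part are nonnegative, hence vanish.\<close>

lemma solution_unique:
  assumes su: "is_solution \<Omega> a q f u" and sv: "is_solution \<Omega> a q f v"
  shows "AE x in M. u x = v x"
proof -
  obtain z \<mu> where u: "in_W0 \<Omega> a q u" and z: "z \<in> borel_measurable M" "AE x in M. norm (z x) \<le> 1"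
    and ez: "\<And>\<phi>. test_fun \<Omega> \<phi> \<Longrightarrow> (LINT x|M. z x \<bullet> grad \<phi> x + q_flux \<Omega> a q u x \<bullet> grad \<phi> x) = (LINT x|M. f x * \<phi> x)"
    and \<mu>: "is_abs_D \<Omega> u \<mu>" "\<And>\<phi>. test_fun \<Omega> \<phi> \<Longrightarrow> pairing_value \<Omega> z u \<phi> (LINT x|\<mu>. \<phi> x)"
    using su unfolding is_solution_def by blast
  obtain w \<nu> where v: "in_W0 \<Omega> a q v" and w: "w \<in> borel_measurable M" "AE x in M. norm (w x) \<le> 1"
    and ew: "\<And>\<phi>. test_fun \<Omega> \<phi> \<Longrightarrow> (LINT x|M. w x \<bullet> grad \<phi> x + q_flux \<Omega> a q v x \<bullet> grad \<phi> x) = (LINT x|M. f x * \<phi> x)"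
    and \<nu>: "is_abs_D \<Omega> v \<nu>" "\<And>\<phi>. test_fun \<Omega> \<phi> \<Longrightarrow> pairing_value \<Omega> w v \<phi> (LINT x|\<nu>. \<phi> x)"
    using sv unfolding is_solution_def by blast
  define G H U V where "G = wgrad \<Omega> u" and "H = wgrad \<Omega> v" and "U = q_flux \<Omega> a q u" and "V = q_flux \<Omega> a q v"
  have GH: "in_L \<Omega> a q G" "in_L \<Omega> a q H" using u v by (auto simp: in_W0_def in_W_def G_def H_def)
  have zG: "AE x in M. norm (G x) \<le> z x \<bullet> G x" unfolding G_def by (rule pairing_eq_norm[OF u z \<mu>])
  have wH: "AE x in M. norm (H x) \<le> w x \<bullet> H x" unfolding H_def by (rule pairing_eq_norm[OF v w \<nu>])
  have dual: "dual z" "dual w" "dual U" "dual V"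
    unfolding U_def V_def by (rule dual_bounded[OF z] dual_bounded[OF w] dual_q_flux[OF u] dual_q_flux[OF v])+
  \<comment> \<open>\<open>T\<close> is the difference of the two equations as a linear functional
    of a vector field. It vanishes on gradients of test functions and, by continuity, on
    \<open>G\<close> and \<open>H\<close> separately, so no approximation of \<open>u - v\<close>
    itself is required.\<close>
  define T where "T g = (LINT x|M. z x \<bullet> g x) + (LINT x|M. U x \<bullet> g x) - (LINT x|M. w x \<bullet> g x) - (LINT x|M. V x \<bullet> g x)" for g
  have T_grad: "T (grad \<phi>) = 0" if \<phi>: "test_fun \<Omega> \<phi>" for \<phi>
    using ez[OF \<phi>] ew[OF \<phi>] dual[THEN dual_integrable(1)[OF _ test_fun_in_L(2)[OF \<phi>]]]
    by (simp add: T_def U_def V_def)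
  have T_wgrad: "T (wgrad \<Omega> u') = 0" if u': "in_W0 \<Omega> a q u'" for u'
  proof -
    obtain \<phi> where \<phi>: "\<And>k. test_fun \<Omega> (\<phi> k)" "(\<lambda>k. norm_L \<Omega> a q (\<lambda>x. wgrad \<Omega> u' x - grad (\<phi> k) x)) \<longlonglongrightarrow> 0"
      using in_W0_approx[OF u'] by metis
    have L: "in_L \<Omega> a q (wgrad \<Omega> u')" using u' by (simp add: in_W0_def in_W_def)
    have "(\<lambda>k. T (grad (\<phi> k))) \<longlonglongrightarrow> T (wgrad \<Omega> u')"
      unfolding T_def by (intro tendsto_intros dual_tendsto[OF _ L test_fun_in_L(2)[OF \<phi>(1)] \<phi>(2)] dual)
    then show ?thesis by (simp add: T_grad[OF \<phi>(1)] LIMSEQ_const_iff)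
  qed
  define m where "m x = (z x - w x) \<bullet> (G x - H x) + (U x - V x) \<bullet> (G x - H x)" for x
  note I = dual[THEN dual_integrable(1)[OF _ GH(1)]] dual[THEN dual_integrable(1)[OF _ GH(2)]]
  have m_eq: "m x = (z x \<bullet> G x + U x \<bullet> G x - w x \<bullet> G x - V x \<bullet> G x) - (z x \<bullet> H x + U x \<bullet> H x - w x \<bullet> H x - V x \<bullet> H x)" for x
    by (simp add: m_def inner_diff_left inner_diff_right)
  have "integrable M m" unfolding m_eq[abs_def] using I by simp
  moreover have "(LINT x|M. m x) = T G - T H"
    unfolding m_eq T_def using I by simp
  then have "(LINT x|M. m x) = 0"
    using T_wgrad[OF u] T_wgrad[OF v] by (simp add: G_def H_def)
  define r where "r x = (norm (G x) powr (q - 2) *\<^sub>R G x - norm (H x) powr (q - 2) *\<^sub>R H x) \<bullet> (G x - H x)" for x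
  have UV: "(U x - V x) \<bullet> (G x - H x) = a x * r x" for x
    by (simp add: U_def V_def q_flux_def G_def H_def r_def inner_diff_left algebra_simps)
  have r: "0 \<le> r x" "r x = 0 \<Longrightarrow> G x = H x" for x
    using flux_strict_mono[OF q, where \<xi>="G x" and \<zeta>="H x"] by (auto simp: r_def)
  \<comment> \<open>Since |z| and |w| are at most 1, z . H <= |H| and w . G <= |G|, while the
    pairing conditions give z . G >= |G| and w . H >= |H|. Hence (z - w) . (G - H) >= 0 and the
    weighted term alone bounds \<open>m\<close> from below.\<close>
  have ge: "AE x in M. a x * r x \<le> m x"
    using zG wH z(2) w(2)
  proof eventually_elim
    fix x assume *: "norm (G x) \<le> z x \<bullet> G x" "norm (H x) \<le> w x \<bullet> H x" "norm (z x) \<le> 1" "norm (w x) \<le> 1"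
    have "z x \<bullet> H x \<le> norm (z x) * norm (H x)" "w x \<bullet> G x \<le> norm (w x) * norm (G x)" by (rule norm_cauchy_schwarz)+
    moreover have "norm (z x) * norm (H x) \<le> 1 * norm (H x)" "norm (w x) * norm (G x) \<le> 1 * norm (G x)"
      using * by (intro mult_right_mono; simp)+
    ultimately have "0 \<le> (z x - w x) \<bullet> (G x - H x)" using * by (simp add: inner_diff_left inner_diff_right)
    then show "a x * r x \<le> m x" unfolding m_def UV by simp
  qed
  have "AE x in M. 0 \<le> m x"
    using ge a_pos
  proof eventually_elim
    show "0 \<le> m x" if "a x * r x \<le> m x" "0 < a x" for x
      using that r(1)[of x] by (meson less_imp_le mult_nonneg_nonneg order_trans)
  qed
  with \<open>integrable M m\<close> \<open>(LINT x|M. m x) = 0\<close> have "AE x in M. m x = 0"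
    using integral_nonneg_eq_0_iff_AE by blast
  then have "AE x in M. G x = H x"
    using ge a_pos
  proof eventually_elim
    fix x assume "m x = 0" "a x * r x \<le> m x" "0 < a x"
    then have "r x \<le> 0" by (simp add: mult_le_0_iff)
    with r show "G x = H x" by (meson antisym)
  qed
  then show ?thesis unfolding G_def H_def by (rule eq_if_wgrad_eq[OF u v])
qed

end

theorem proposition3p10:
  fixes \<Omega> :: "(real ^ 'n::finite) set"
    and a f u v :: "real ^ 'n \<Rightarrow> real"
    and p q :: real
  assumes "bounded_lipschitz_domain \<Omega>"
    and "\<forall>x\<in>closure \<Omega>. 0 \<le> a x"
    and "\<exists>L. L-lipschitz_on (closure \<Omega>) a"
    and "muckenhoupt \<Omega> q a"
    and "\<forall>x\<in>frontier \<Omega>. a x \<noteq> 0"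
    and "1 < p" and "p < q" and "q < real CARD('n)"
    and "q / p < 1 + 1 / real CARD('n)"
    and "in_L \<Omega> (\<lambda>_. 1) (real CARD('n)) f"
    and "norm_L \<Omega> (\<lambda>_. 1) (real CARD('n)) f * (sobolev_const TYPE('n) 1 + 1) < 1"
    and "is_solution \<Omega> a q f u" and "is_solution \<Omega> a q f v"
  shows "AE x in lebesgue_on \<Omega>. u x = v x"
proof -
  have op: "open \<Omega>" and bd: "bounded \<Omega>" using assms(1) by (auto simp: bounded_lipschitz_domain_def)
  have q: "1 < q" using assms(6,7) by simp
  \<comment> \<open>Continuity up to the boundary yields both the upper bound \<open>C\<close> on
    the compact closure and positivity of \<open>a\<close> near boundary points.\<close>
  have cont: "continuous_on (closure \<Omega>) a" using assms(3) lipschitz_on_continuous_on by blast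
  then have "compact (a ` closure \<Omega>)" using bd by (intro compact_continuous_image) auto
  then obtain C where C: "\<And>x. x \<in> closure \<Omega> \<Longrightarrow> \<bar>a x\<bar> \<le> C"
    using compact_imp_bounded[of "a ` closure \<Omega>"] by (auto simp: bounded_iff)
  have "weight \<Omega> a q C"
  proof
    show "a x \<le> C" "0 \<le> a x" if "x \<in> \<Omega>" for x
      using that closure_subset[of \<Omega>] C[of x] assms(2) by auto
    show "a \<in> borel_measurable (lebesgue_on \<Omega>)" "AE x in lebesgue_on \<Omega>. 0 < a x"
      using assms(4) by (auto simp: muckenhoupt_def Linfty_def)
    show "integrable (lebesgue_on \<Omega>) (\<lambda>x. a x powr (- 1 / (q - 1)))"
      by (rule muckenhoupt_integrable[OF op bd assms(2) cont assms(5) q assms(4)])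
  qed (fact op bd q)+
  then show ?thesis using assms(12,13) by (rule weight.solution_unique)
qed

end
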